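(* Let $B\subset\mathbb{R}^2$ be a union of finitely many line segments and let $K\subset\mathbb{R}^2$ be a convex body with interior points. Then $$B \text{ is a weak barrier for } K \iff \nabla K\subset \mathrm{co}(B).$$ In particular, if $B$ is a weak barrier for $K$, then $|B|\ge \tfrac12|\partial K|$.
   Context: A convex body is a non-empty compact convex set. $|\cdot|=\mathcal{H}^1$ denotes length (one-dimensional Hausdorff measure), and $\partial K$ is the boundary of $K$. Weak barrier (planar case): $B\subset\mathbb{R}^2$ is a weak barrier for $K$ if for any line $g$ through the origin, the total projection length of $B$ onto $g$ (with multiplicities) is at least the length of the orthogonal projection of $K$ onto $g$. The total projection length with multiplicities is $\int_{g}\#\big(B\cap (x+g^\perp)\big)\,\mathcal{H}^1(\mathrm{d}x)$, where $g^\perp$ is the line through the origin orthogonal to $g$; equivalently, it is the sum of the lengths of the projections onto $g$ of the segments constituting $B$. Blaschke body: for a planar convex body $K$ with interior points, $\nabla K=\tfrac12(K+(-K))$ (Minkowski sum). Convexification $\mathrm{co}(B)$: write $B=s_1\cup\dots\cup s_m$ with non-degenerate line segments $s_i$, any two of which have at most finitely many points in common. Order the segments by increasing angle in $[0,\pi)$ with respect to the horizontal axis and fit translates of them together in this order to form a convex polygonal curve. Translate this curve so that the midpoint of its two endpoints is the origin. The union of this curve and its reflection at the origin is the boundary of the convex set $\mathrm{co}(B)$. Equivalently, $\mathrm{co}(B)$ is the translate of the Minkowski sum $s_1+\dots+s_m$ that is symmetric with respect to the origin, i.e. $\mathrm{co}(B)=\sum_{i=1}^m (s_i-m_i)$ with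 $m_i$ the midpoint of $s_i$ (this includes the degenerate case where all segments are parallel). This is different from the convex hull of $B$. *)

theory Defs
  imports "HOL-Analysis.Analysis"
begin

section \<open>One-dimensional Hausdorff measure\<close>

text \<open>
  The boundedness condition is needed because \<^const>\<open>diameter\<close> is unspecified on unbounded sets.
\<close>

definition hausdorff_content :: "real \<Rightarrow> 'a::metric_space set \<Rightarrow> ennreal" where
  "hausdorff_content \<delta> A =
     (INF U \<in> {U :: nat \<Rightarrow> 'a set. A \<subseteq> (\<Union>i. U i) \<and> (\<forall>i. bounded (U i) \<and> diameter (U i) \<le> \<delta>)}.
        \<Sum>i. ennreal (diameter (U i)))"

definition hausdorff_outer :: "'a::metric_space set \<Rightarrow> ennreal" where
  "hausdorff_outer A = (SUP \<delta> \<in> {0<..}. hausdorff_content \<delta> A)"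

definition hausdorff :: "'a::metric_space measure" where
  "hausdorff = measure_of UNIV (sets borel) hausdorff_outer"

text \<open>
  \<^const>\<open>measure_of\<close> yields the null measure if its argument is not countably additive. That this does
  not happen is Caratheodory's criterion for metric outer measures; it is proved here so that
  \<^const>\<open>hausdorff\<close> agrees with \<^const>\<open>hausdorff_outer\<close> on all Borel sets.
\<close>

lemma hausdorff_content_antimono:
  "\<delta> \<le> \<epsilon> \<Longrightarrow> hausdorff_content \<epsilon> A \<le> hausdorff_content \<delta> A"
  unfolding hausdorff_content_def
  by (rule INF_superset_mono) (auto intro: order_trans)

lemma hausdorff_content_mono:
  "A \<subseteq> B \<Longrightarrow> hausdorff_content \<delta> A \<le> hausdorff_content \<delta> B"
  unfolding hausdorff_content_def
  by (rule INF_superset_mono) auto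

lemma hausdorff_content_empty: "\<delta> > 0 \<Longrightarrow> hausdorff_content \<delta> {} = 0"
  unfolding hausdorff_content_def
  by (intro antisym INF_lower2[where i="\<lambda>_. {}"]) auto

lemma hausdorff_content_subadditive:
  fixes A :: "nat \<Rightarrow> 'a::metric_space set"
  shows "hausdorff_content \<delta> (\<Union>i. A i) \<le> (\<Sum>i. hausdorff_content \<delta> (A i))"
proof (cases "\<forall>i. hausdorff_content \<delta> (A i) < top")
  case False
  then obtain i where "hausdorff_content \<delta> (A i) = top"
    by (metis top.not_eq_extremum)
  moreover have "hausdorff_content \<delta> (A i) \<le> (\<Sum>i. hausdorff_content \<delta> (A i))"
    using sum_le_suminf[of "\<lambda>i. hausdorff_content \<delta> (A i)" "{i}"] by simp
  ultimately show ?thesis by (simp add: top_unique)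
next
  case True
  show ?thesis
  proof (rule ennreal_le_epsilon)
    fix e :: real assume e: "0 < e"
    have "\<exists>U. A i \<subseteq> (\<Union>j. U j) \<and> (\<forall>j. bounded (U j) \<and> diameter (U j) \<le> \<delta>) \<and>
        (\<Sum>j. ennreal (diameter (U j))) \<le> hausdorff_content \<delta> (A i) + ennreal (e * (1/2)^Suc i)" for i
    proof -
      have "hausdorff_content \<delta> (A i) < hausdorff_content \<delta> (A i) + ennreal (e * (1/2)^Suc i)"
        using True e by (auto simp: ennreal_add_left_cancel_less less_top)
      then show ?thesis
        unfolding hausdorff_content_def[of \<delta> "A i"] INF_less_iff
        by (auto intro: less_imp_le)
    qed
    then obtain U where U: "\<And>i. A i \<subseteq> (\<Union>j. U i j)" "\<And>i j. bounded (U i j)"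
      "\<And>i j. diameter (U i j) \<le> \<delta>"
      "\<And>i. (\<Sum>j. ennreal (diameter (U i j))) \<le> hausdorff_content \<delta> (A i) + ennreal (e * (1/2)^Suc i)"
      by metis
    define V where "V k = (case prod_decode k of (i, j) \<Rightarrow> U i j)" for k
    have "(\<Union>i. A i) \<subseteq> (\<Union>k. V k)"
    proof
      fix x assume "x \<in> (\<Union>i. A i)"
      then obtain i j where "x \<in> U i j" using U(1) by blast
      then have "x \<in> V (prod_encode (i, j))" by (simp add: V_def)
      then show "x \<in> (\<Union>k. V k)" by blast
    qed
    then have "hausdorff_content \<delta> (\<Union>i. A i) \<le> (\<Sum>k. ennreal (diameter (V k)))"
      unfolding hausdorff_content_def
      using U(2,3) by (intro INF_lower) (auto simp: V_def split: prod.split)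
    also have "\<dots> = (\<Sum>k. (\<lambda>(i, j). ennreal (diameter (U i j))) (prod_decode k))"
      by (intro suminf_cong) (simp add: V_def split: prod.split)
    also have "\<dots> = (\<Sum>i. \<Sum>j. ennreal (diameter (U i j)))"
      by (rule suminf_ennreal_2dimen) simp
    also have "\<dots> \<le> (\<Sum>i. hausdorff_content \<delta> (A i) + ennreal (e * (1/2)^Suc i))"
      using U(4) by (intro suminf_le) auto
    also have "\<dots> = (\<Sum>i. hausdorff_content \<delta> (A i)) + (\<Sum>i. ennreal (e * (1/2)^Suc i))"
      by (intro suminf_add[symmetric]) auto
    also have "(\<Sum>i. ennreal (e * (1/2)^Suc i)) = ennreal (e * 1)"
      using e by (intro suminf_ennreal_eq sums_mult power_half_series) auto
    finally show "hausdorff_content \<delta> (\<Union>i. A i) \<le> (\<Sum>i. hausdorff_content \<delta> (A i)) + ennreal e"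
      by simp
  qed
qed

lemma hausdorff_outer_mono: "A \<subseteq> B \<Longrightarrow> hausdorff_outer A \<le> hausdorff_outer B"
  unfolding hausdorff_outer_def by (intro SUP_mono) (auto intro: hausdorff_content_mono)

lemma hausdorff_outer_empty: "hausdorff_outer {} = 0"
  unfolding hausdorff_outer_def by (simp add: hausdorff_content_empty)

lemma hausdorff_outer_subadditive:
  "hausdorff_outer (\<Union>i. A i) \<le> (\<Sum>i. hausdorff_outer (A i))"
  unfolding hausdorff_outer_def[of "\<Union>i. A i"]
proof (rule SUP_least)
  fix \<delta> :: real assume "\<delta> \<in> {0<..}"
  then have "hausdorff_content \<delta> (A i) \<le> hausdorff_outer (A i)" for i
    unfolding hausdorff_outer_def by (intro SUP_upper)
  then show "hausdorff_content \<delta> (\<Union>i. A i) \<le> (\<Sum>i. hausdorff_outer (A i))"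
    by (intro order_trans[OF hausdorff_content_subadditive] suminf_le) auto
qed

lemma outer_measure_space_hausdorff: "outer_measure_space (Pow UNIV) hausdorff_outer"
  unfolding outer_measure_space_def positive_def increasing_def countably_subadditive_def
  by (simp add: hausdorff_outer_empty hausdorff_outer_subadditive hausdorff_outer_mono)

lemma hausdorff_outer_Un: "hausdorff_outer (A \<union> B) \<le> hausdorff_outer A + hausdorff_outer B"
proof -
  have "hausdorff_outer (A \<union> B) = hausdorff_outer (\<Union>i. binaryset A B i)"
    by (simp only: UN_binaryset_eq)
  also have "\<dots> \<le> (\<Sum>i. hausdorff_outer (binaryset A B i))"
    by (rule hausdorff_outer_subadditive)
  also have "\<dots> = hausdorff_outer A + hausdorff_outer B"
    by (rule suminf_binaryset_eq) (rule hausdorff_outer_empty)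
  finally show ?thesis .
qed

lemma hausdorff_outer_separated:
  assumes r: "r > 0" and sep: "\<And>x y. x \<in> A \<Longrightarrow> y \<in> B \<Longrightarrow> r \<le> dist x y"
  shows "hausdorff_outer A + hausdorff_outer B \<le> hausdorff_outer (A \<union> B)"
proof -
  have content: "hausdorff_content \<delta> A + hausdorff_content \<delta> B \<le> hausdorff_content \<delta> (A \<union> B)"
    if \<delta>: "0 < \<delta>" "\<delta> < r" for \<delta>
    unfolding hausdorff_content_def[of \<delta> "A \<union> B"]
  proof (rule INF_greatest, clarify)
    fix U :: "nat \<Rightarrow> 'a set"
    assume cov: "A \<union> B \<subseteq> (\<Union>i. U i)" and U: "\<forall>i. bounded (U i) \<and> diameter (U i) \<le> \<delta>"
    define V where "V i = (if U i \<inter> A = {} then {} else U i)" for i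
    define W where "W i = (if U i \<inter> A = {} then U i else {})" for i
    have disj: "U i \<inter> A = {}" if "x \<in> B" "x \<in> U i" for x i
    proof (rule ccontr)
      assume "U i \<inter> A \<noteq> {}"
      then obtain y where y: "y \<in> U i" "y \<in> A" by blast
      have "r \<le> dist y x" using sep y that by blast
      also have "\<dots> \<le> diameter (U i)" using U y that by (intro diameter_bounded_bound) auto
      finally show False using U \<delta> by (meson not_le order_le_less_trans)
    qed
    have "A \<subseteq> (\<Union>i. V i)" using cov by (fastforce simp: V_def)
    then have "hausdorff_content \<delta> A \<le> (\<Sum>i. ennreal (diameter (V i)))"
      unfolding hausdorff_content_def using U \<delta> by (intro INF_lower) (auto simp: V_def)
    moreover have "B \<subseteq> (\<Union>i. W i)" 
    proof
      fix x assume x: "x \<in> B"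
      then obtain i where "x \<in> U i" using cov by blast
      with disj[OF x this] have "x \<in> W i" by (simp add: W_def)
      then show "x \<in> (\<Union>i. W i)" by blast
    qed
    then have "hausdorff_content \<delta> B \<le> (\<Sum>i. ennreal (diameter (W i)))"
      unfolding hausdorff_content_def using U \<delta> by (intro INF_lower) (auto simp: W_def)
    ultimately have "hausdorff_content \<delta> A + hausdorff_content \<delta> B
        \<le> (\<Sum>i. ennreal (diameter (V i))) + (\<Sum>i. ennreal (diameter (W i)))"
      by (rule add_mono)
    also have "\<dots> = (\<Sum>i. ennreal (diameter (V i)) + ennreal (diameter (W i)))"
      by (intro suminf_add) auto
    also have "\<dots> = (\<Sum>i. ennreal (diameter (U i)))"
      by (intro suminf_cong) (auto simp: V_def W_def)
    finally show "hausdorff_content \<delta> A + hausdorff_content \<delta> B \<le> (\<Sum>i. ennreal (diameter (U i)))" .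
  qed
  have bound: "hausdorff_content \<delta> A + hausdorff_content \<epsilon> B \<le> hausdorff_outer (A \<union> B)"
    if "0 < \<delta>" "0 < \<epsilon>" for \<delta> \<epsilon>
  proof -
    define \<eta> where "\<eta> = Min {\<delta>, \<epsilon>, r / 2}"
    have \<eta>: "0 < \<eta>" "\<eta> < r" "\<eta> \<le> \<delta>" "\<eta> \<le> \<epsilon>" using that r by (auto simp: \<eta>_def min_def)
    have "hausdorff_content \<delta> A + hausdorff_content \<epsilon> B \<le> hausdorff_content \<eta> A + hausdorff_content \<eta> B"
      using \<eta> by (intro add_mono hausdorff_content_antimono)
    also have "\<dots> \<le> hausdorff_content \<eta> (A \<union> B)" using \<eta> content by blast
    also have "\<dots> \<le> hausdorff_outer (A \<union> B)"
      unfolding hausdorff_outer_def using \<eta> by (intro SUP_upper) auto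
    finally show ?thesis .
  qed
  have "hausdorff_outer A + hausdorff_content \<epsilon> B \<le> hausdorff_outer (A \<union> B)" if "0 < \<epsilon>" for \<epsilon>
    unfolding hausdorff_outer_def[of A]
    using bound that by (subst ennreal_SUP_add_left[symmetric]) (auto intro!: SUP_least)
  then show ?thesis
    unfolding hausdorff_outer_def[of B]
    by (subst ennreal_SUP_add_right) (auto intro!: SUP_least)
qed

lemma hausdorff_outer_closed_split:
  fixes F A :: "'a::metric_space set"
  assumes F: "closed F" "F \<noteq> {}"
  shows "hausdorff_outer (A \<inter> F) + hausdorff_outer (A - F) \<le> hausdorff_outer A"
proof (cases "hausdorff_outer A < top")
  case False
  then have "hausdorff_outer A = top" by (metis top.not_eq_extremum)
  then show ?thesis by simp
next
  case True
  define D where "D n = {x \<in> A. 1 / real (Suc n) \<le> infdist x F}" for n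
  define R where "R n = {x \<in> A. 1 / real (Suc (Suc n)) \<le> infdist x F \<and> infdist x F < 1 / real (Suc n)}" for n
  have near: "infdist x F \<le> infdist y F + dist x y" for x y
    by (rule infdist_triangle)
  have sums: "(\<Sum>k<n. hausdorff_outer (R (2 * k + c))) \<le> hausdorff_outer (\<Union>k<n. R (2 * k + c))" for n c
  proof (induction n)
    case (Suc n)
    have "hausdorff_outer (\<Union>k<n. R (2 * k + c)) + hausdorff_outer (R (2 * n + c))
        \<le> hausdorff_outer ((\<Union>k<n. R (2 * k + c)) \<union> R (2 * n + c))"
    proof (rule hausdorff_outer_separated)
      let ?r = "1 / real (2 * n + c) - 1 / real (2 * n + c + 1)"
      have "1 / real (2 * n + c + 1) < 1 / real (2 * n + c)" if "n \<noteq> 0"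
        using that by (intro divide_strict_left_mono mult_pos_pos) auto
      then show "0 < (if n = 0 then 1 else ?r)" by simp
      fix x y assume "x \<in> (\<Union>k<n. R (2 * k + c))" and y: "y \<in> R (2 * n + c)"
      then obtain k where k: "k < n" "x \<in> R (2 * k + c)" by blast
      have "1 / real (2 * n + c) \<le> 1 / real (Suc (Suc (2 * k + c)))"
        using k by (intro divide_left_mono) auto
      also have "\<dots> \<le> infdist x F" using k by (simp add: R_def)
      finally have "1 / real (2 * n + c) \<le> infdist x F" .
      moreover have "infdist y F < 1 / real (2 * n + c + 1)" using y by (simp add: R_def)
      ultimately show "(if n = 0 then 1 else ?r) \<le> dist x y"
        using near[of x y] k by auto
    qed
    moreover have "(\<Union>k<n. R (2 * k + c)) \<union> R (2 * n + c) = (\<Union>k<Suc n. R (2 * k + c))"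
      by (auto simp: lessThan_Suc)
    ultimately show ?case
      using add_right_mono[OF Suc, of "hausdorff_outer (R (2 * n + c))"]
      by (simp only: sum.lessThan_Suc)
  qed (simp add: hausdorff_outer_empty)
  have "(\<Sum>k. hausdorff_outer (R (2 * k + c))) \<le> hausdorff_outer A" for c
    by (intro suminf_le_const summableI order_trans[OF sums] hausdorff_outer_mono) (auto simp: R_def)
  then have fin: "(\<Sum>k. hausdorff_outer (R (2 * k + c))) < top" for c
    using True by (rule le_less_trans)
  have "(\<Sum>k<n. hausdorff_outer (R k)) \<le>
      (\<Sum>k. hausdorff_outer (R (2 * k + 0))) + (\<Sum>k. hausdorff_outer (R (2 * k + 1)))" for n
  proof -
    have "(\<Sum>k<n. hausdorff_outer (R k)) \<le> (\<Sum>k<2 * n. hausdorff_outer (R k))"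
      by (intro sum_mono2) auto
    also have "\<dots> = (\<Sum>k<n. hausdorff_outer (R (2 * k + 0)) + hausdorff_outer (R (2 * k + 1)))"
      by (induction n) (auto simp: add.assoc)
    also have "\<dots> = (\<Sum>k<n. hausdorff_outer (R (2 * k + 0))) + (\<Sum>k<n. hausdorff_outer (R (2 * k + 1)))"
      by (rule sum.distrib)
    also have "\<dots> \<le> (\<Sum>k. hausdorff_outer (R (2 * k + 0))) + (\<Sum>k. hausdorff_outer (R (2 * k + 1)))"
      by (intro add_mono sum_le_suminf) auto
    finally show ?thesis .
  qed
  then have "(\<Sum>k. hausdorff_outer (R k)) \<le>
      (\<Sum>k. hausdorff_outer (R (2 * k + 0))) + (\<Sum>k. hausdorff_outer (R (2 * k + 1)))"
    by (intro suminf_le_const) auto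
  then have tot: "(\<Sum>k. hausdorff_outer (R k)) \<noteq> top"
    using fin[of 0] fin[of 1] by (auto simp: top_unique)
  have split: "hausdorff_outer (A \<inter> F) + hausdorff_outer (A - F)
      \<le> hausdorff_outer A + (\<Sum>k. hausdorff_outer (R (k + n)))" for n
  proof -
    have "A - F \<subseteq> D n \<union> (\<Union>k. R (k + n))"
    proof
      fix x assume x: "x \<in> A - F"
      then have pos: "0 < infdist x F" using infdist_pos_not_in_closed F by auto
      then obtain m where m: "1 / real (Suc m) < infdist x F"
        by (rule nat_approx_posE)
      show "x \<in> D n \<union> (\<Union>k. R (k + n))"
      proof (cases "x \<in> D n")
        case False
        define p where "p = (LEAST p. 1 / real (Suc p) \<le> infdist x F)"
        have p: "1 / real (Suc p) \<le> infdist x F"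
          unfolding p_def by (rule LeastI[where k=m]) (use m in simp)
        have "n < p"
        proof (rule ccontr)
          assume "\<not> n < p"
          then have "1 / real (Suc n) \<le> 1 / real (Suc p)" by (intro divide_left_mono) auto
          with p False x show False by (auto simp: D_def)
        qed
        then obtain q where q: "p = Suc (q + n)"
          using less_imp_Suc_add[of n p] by (auto simp: add.commute)
        have "\<not> 1 / real (Suc (q + n)) \<le> infdist x F"
          using not_less_Least[of "q + n" "\<lambda>p. 1 / real (Suc p) \<le> infdist x F"] q
          by (simp add: p_def)
        then have "x \<in> R (q + n)" using p q x by (auto simp: R_def)
        then show ?thesis by blast
      qed auto
    qed
    then have "hausdorff_outer (A - F) \<le> hausdorff_outer (D n) + hausdorff_outer (\<Union>k. R (k + n))"
      by (rule order_trans[OF hausdorff_outer_mono hausdorff_outer_Un])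
    also have "\<dots> \<le> hausdorff_outer (D n) + (\<Sum>k. hausdorff_outer (R (k + n)))"
      by (intro add_left_mono hausdorff_outer_subadditive)
    finally have "hausdorff_outer (A \<inter> F) + hausdorff_outer (A - F)
        \<le> (hausdorff_outer (A \<inter> F) + hausdorff_outer (D n)) + (\<Sum>k. hausdorff_outer (R (k + n)))"
      by (simp add: add.assoc add_left_mono)
    also have "hausdorff_outer (A \<inter> F) + hausdorff_outer (D n) \<le> hausdorff_outer (A \<inter> F \<union> D n)"
    proof (rule hausdorff_outer_separated)
      fix x y assume "x \<in> A \<inter> F" "y \<in> D n"
      then show "1 / real (Suc n) \<le> dist x y"
        using infdist_le[of x F y] by (auto simp: D_def dist_commute)
    qed simp
    also have "hausdorff_outer (A \<inter> F \<union> D n) \<le> hausdorff_outer A"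
      by (intro hausdorff_outer_mono) (auto simp: D_def)
    finally show ?thesis by (simp add: add_right_mono)
  qed
  have "(\<lambda>n. \<Sum>k. hausdorff_outer (R (k + n))) \<longlonglongrightarrow> 0"
  proof -
    have *: "hausdorff_outer (R k) \<noteq> top" for k
      using tot sum_le_suminf[of "\<lambda>k. hausdorff_outer (R k)" "{k}"] by (auto simp: top_unique)
    define a where "a k = enn2real (hausdorff_outer (R k))" for k
    have a: "hausdorff_outer (R k) = ennreal (a k)" "0 \<le> a k" for k
      using * by (auto simp: a_def less_top)
    have s: "summable a"
      using tot a by (auto intro: summable_suminf_not_top)
    have "(\<Sum>k. hausdorff_outer (R (k + n))) = ennreal (\<Sum>k. a (k + n))" for n
      unfolding a(1) using a s by (intro suminf_ennreal2) (auto simp: summable_iff_shift)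
    moreover have "(\<lambda>n. ennreal (\<Sum>k. a (k + n))) \<longlonglongrightarrow> ennreal 0"
      using suminf_exist_split2[OF s] by (intro tendsto_ennrealI) simp
    ultimately show ?thesis by simp
  qed
  from tendsto_add[OF tendsto_const[of "hausdorff_outer A"] this]
  have "(\<lambda>n. hausdorff_outer A + (\<Sum>k. hausdorff_outer (R (k + n)))) \<longlonglongrightarrow> hausdorff_outer A"
    by simp
  then show ?thesis
    by (rule LIMSEQ_le_const) (use split in auto)
qed

lemma measure_space_hausdorff:
  "measure_space UNIV (sets borel) (hausdorff_outer :: 'a::metric_space set \<Rightarrow> ennreal)"
proof -
  let ?L = "lambda_system UNIV (Pow UNIV) (hausdorff_outer :: 'a set \<Rightarrow> ennreal)"
  have sa: "sigma_algebra UNIV (Pow UNIV :: 'a set set)" by (rule sigma_algebra_Pow)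
  have alg: "algebra UNIV (Pow UNIV :: 'a set set)" by (rule algebra_Pow)
  have ms: "measure_space UNIV ?L hausdorff_outer"
    by (rule sigma_algebra.caratheodory_lemma[OF sa outer_measure_space_hausdorff])
  then have L: "sigma_algebra UNIV ?L" by (simp add: measure_space_def)
  have closed: "F \<in> ?L" if "closed F" for F
  proof (cases "F = {}")
    case True
    then show ?thesis
      by (simp add: lambda_system_def hausdorff_outer_empty)
  next
    case False
    have "hausdorff_outer (A \<inter> F) + hausdorff_outer (A - F) = hausdorff_outer A" for A
      using hausdorff_outer_closed_split[OF that False, of A]
        hausdorff_outer_Un[of "A \<inter> F" "A - F"] by (simp add: Int_Diff_Un antisym)
    then show ?thesis
      by (simp add: lambda_system_def Int_commute Diff_eq)
  qed
  have "sets borel \<subseteq> ?L"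
    unfolding borel_eq_closed
    using sigma_algebra.sigma_sets_subset[OF L, of "Collect closed"] closed
    by (auto simp: sets_measure_of)
  moreover have "sigma_algebra UNIV (sets (borel :: 'a measure))"
    by (metis sets.sigma_algebra_axioms space_borel)
  ultimately show ?thesis
    using ms by (auto simp: measure_space_def positive_def countably_additive_def subset_iff)
qed

lemma space_hausdorff [simp]: "space hausdorff = UNIV"
  by (simp add: hausdorff_def space_measure_of_conv)

lemma sets_hausdorff [simp, measurable_cong]:
  "sets (hausdorff :: 'a::metric_space measure) = sets borel"
proof -
  have "sets (measure_of (space borel) (sets (borel :: 'a measure)) hausdorff_outer) = sets borel"
    by (rule sets.sets_measure_of_eq)
  then show ?thesis by (simp only: hausdorff_def space_borel)
qed

lemma emeasure_hausdorff:
  fixes A :: "'a::metric_space set"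
  assumes "A \<in> sets borel"
  shows "emeasure hausdorff A = hausdorff_outer A"
proof (rule emeasure_measure_of[OF hausdorff_def])
  show "sets (borel :: 'a measure) \<subseteq> Pow UNIV" by simp
  show "A \<in> sets hausdorff" using assms by (simp only: sets_hausdorff)
  show "positive (sets (hausdorff :: 'a measure)) hausdorff_outer"
    "countably_additive (sets (hausdorff :: 'a measure)) hausdorff_outer"
    using measure_space_hausdorff[where 'a='a] by (simp_all only: measure_space_def sets_hausdorff)
qed


section \<open>Weak barriers, Blaschke bodies and convexification\<close>

definition convex_body :: "'a::euclidean_space set \<Rightarrow> bool" where
  "convex_body K \<longleftrightarrow> K \<noteq> {} \<and> compact K \<and> convex K"

text \<open>
  A segment is represented by the pair of its endpoints.
\<close>

definition nondegenerate_segments :: "((real^2) \<times> (real^2)) set \<Rightarrow> bool" where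
  "nondegenerate_segments S \<longleftrightarrow> finite S \<and> (\<forall>(a, b)\<in>S. a \<noteq> b)"

definition finite_segment_union :: "(real^2) set \<Rightarrow> bool" where
  "finite_segment_union B \<longleftrightarrow>
     (\<exists>S. nondegenerate_segments S \<and> B = (\<Union>(a, b)\<in>S. closed_segment a b))"

definition segment_decomposition :: "((real^2) \<times> (real^2)) set \<Rightarrow> (real^2) set \<Rightarrow> bool" where
  "segment_decomposition S B \<longleftrightarrow>
     nondegenerate_segments S \<and>
     B = (\<Union>(a, b)\<in>S. closed_segment a b) \<and>
     (\<forall>(a, b)\<in>S. \<forall>(c, d)\<in>S. (a, b) \<noteq> (c, d) \<longrightarrow> finite (closed_segment a b \<inter> closed_segment c d))"

definition line_through_origin :: "(real^2) set \<Rightarrow> bool" where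
  "line_through_origin g \<longleftrightarrow> subspace g \<and> dim g = 1"

definition orthogonal_projection :: "(real^2) set \<Rightarrow> (real^2) set \<Rightarrow> (real^2) set" where
  "orthogonal_projection g A = {p \<in> g. \<exists>x\<in>A. x - p \<in> orthogonal_comp g}"

definition total_projection_length :: "(real^2) set \<Rightarrow> (real^2) set \<Rightarrow> ennreal" where
  "total_projection_length B g =
     (\<integral>\<^sup>+x\<in>g. emeasure (count_space UNIV) (B \<inter> (+) x ` orthogonal_comp g) \<partial>hausdorff)"

definition weak_barrier :: "(real^2) set \<Rightarrow> (real^2) set \<Rightarrow> bool" where
  "weak_barrier B K \<longleftrightarrow>
     (\<forall>g. line_through_origin g \<longrightarrow>
        total_projection_length B g \<ge> emeasure hausdorff (orthogonal_projection g K))"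

text \<open>
  The reflected set is written as an image, since unary minus on sets is the complement.
  Sums of sets are Minkowski sums.
\<close>

definition blaschke_body :: "(real^2) set \<Rightarrow> (real^2) set" where
  "blaschke_body K = (\<lambda>x. (1/2) *\<^sub>R x) ` (K + uminus ` K)"

text \<open>
  The sum of the centred segments is the origin-symmetric zonogon obtained by fitting together
  translates of the segments ordered by angle and reflecting the resulting curve at the origin. It
  does not depend on the decomposition chosen, whence the definite description.
\<close>

definition convexification :: "(real^2) set \<Rightarrow> (real^2) set" where
  "convexification B =
     (THE C. \<exists>S. segment_decomposition S B \<and>
        C = (\<Sum>(a, b)\<in>S. (\<lambda>x. x - midpoint a b) ` closed_segment a b))"

end

theory Submission
  imports Defs
begin

text \<open>
  A decomposition of \<open>B\<close> into essentially disjoint segments \<open>[a, b]\<close> gives the total projection length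
  onto the line spanned by a unit vector \<open>u\<close> as the sum of all \<open>\<bar>(b - a) \<bullet> u\<bar>\<close>. This sum is also the width
  in direction \<open>u\<close> of the zonogon \<open>co(B)\<close>, so the weak barrier condition compares the support functions
  of \<open>\<nabla>K\<close> and \<open>co(B)\<close>; that suffices for the inclusion because \<open>co(B)\<close> is closed and convex.

  For the length estimate, circumscribe to \<open>K\<close> a polygon with \<open>2m\<close> equally spaced normals. The nearest point
  map of \<open>K\<close> is 1-Lipschitz and maps the sides of the polygon onto the boundary of \<open>K\<close>, and the perimeter
  of the polygon is \<open>tan(\<pi>/2m)\<close> times the sum of the widths of \<open>K\<close> in the \<open>2m\<close> directions. Bounding the
  widths by the projections of the segments and summing over the directions gives at most
  \<open>2 \<bar>B\<bar> / cos(\<pi>/2m)\<close>; then \<open>m \<longlonglongrightarrow> \<infinity>\<close>.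
\<close>

section \<open>Hausdorff measure of segments\<close>

text \<open>For each scale, cut the interval into \<open>n\<close> pieces of equal length
  \<open>h \<le> \<delta>\<close>. Their images have diameter at most \<open>h\<close>, and
  \<open>n\<close> times \<open>h\<close> is \<open>b - a\<close> whatever the scale.\<close>

lemma hausdorff_outer_lipschitz_image_le:
  fixes f :: "real \<Rightarrow> 'a::real_normed_vector"
  assumes f: "1-lipschitz_on {a..b} f" and ab: "a \<le> b"
  shows "hausdorff_outer (f ` {a..b}) \<le> ennreal (b - a)"
  unfolding hausdorff_outer_def
proof (rule SUP_least)
  fix \<delta> :: real assume "\<delta> \<in> {0<..}"
  then have \<delta>: "\<delta> > 0" by simp
  obtain n where n: "(b - a) / \<delta> < real n" using reals_Archimedean2 by blast
  then have n0: "n > 0" using ab \<delta> by (cases n) (auto simp: divide_less_0_iff)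
  define h where "h = (b - a) / real n"
  have h: "0 \<le> h" "h \<le> \<delta>" "real n * h = b - a"
    using ab \<delta> n n0 by (auto simp: h_def field_simps)
  define I where "I i = {a + real i * h .. a + (real i + 1) * h}" for i
  define U where "U i = (if i < n then f ` (I i) else {})" for i
  have sub: "I i \<subseteq> {a..b}" if "i < n" for i
  proof -
    have "(real i + 1) * h \<le> real n * h" using that h(1) by (intro mult_right_mono) auto
    then show ?thesis using h by (auto simp: I_def intro: order_trans[of _ "a + real i * h"])
  qed
  have dist: "dist x y \<le> h" if "x \<in> U i" "y \<in> U i" for x y i
  proof -
    from that obtain s t where st: "i < n" "s \<in> I i" "t \<in> I i" "x = f s" "y = f t"
      by (auto simp: U_def split: if_splits)
    have "dist x y \<le> 1 * dist s t"
      unfolding st by (rule lipschitz_onD[OF f]) (use st sub in blast)+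
    also have "\<dots> \<le> h" using st(2,3) by (auto simp: I_def dist_real_def algebra_simps)
    finally show ?thesis .
  qed
  have diam: "diameter (U i) \<le> h" for i
    using dist h by (intro diameter_le) (auto simp: dist_norm)
  have bdd: "bounded (U i)" for i
    unfolding bounded_def using dist by blast
  have cover: "f ` {a..b} \<subseteq> (\<Union>i. U i)"
  proof clarify
    fix x assume x: "x \<in> {a..b}"
    have "\<exists>i<n. x \<in> I i"
    proof (cases "h = 0")
      case True
      then show ?thesis using n0 h x by (intro exI[of _ 0]) (auto simp: I_def)
    next
      case False
      then have h0: "h > 0" using h by simp
      define k where "k = nat \<lfloor>(x - a) / h\<rfloor>"
      have k: "real k \<le> (x - a) / h" "(x - a) / h < real k + 1"
        using x h0 by (auto simp: k_def)
      then have xk: "a + real k * h \<le> x" "x < a + (real k + 1) * h"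
        using h0 by (auto simp: field_simps)
      show ?thesis
      proof (cases "k < n")
        case True
        then show ?thesis using xk by (auto simp: I_def)
      next
        \<comment> \<open>The floor reaches \<open>n\<close> only at the right endpoint, which
          belongs to the last closed piece, with index \<open>n - 1\<close>.\<close>
        case False
        then have "real n * h \<le> real k * h" using h0 by (intro mult_right_mono) auto
        then have "x = b" using xk x h(3) by auto
        then show ?thesis using h n0 by (intro exI[of _ "n - 1"]) (auto simp: I_def algebra_simps of_nat_diff)
      qed
    qed
    then show "f x \<in> (\<Union>i. U i)" by (auto simp: U_def)
  qed
  have "hausdorff_content \<delta> (f ` {a..b}) \<le> (\<Sum>i. ennreal (diameter (U i)))"
    unfolding hausdorff_content_def
    using cover bdd order_trans[OF diam h(2)] by (intro INF_lower) auto
  also have "\<dots> = (\<Sum>i<n. ennreal (diameter (U i)))"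
    by (rule suminf_finite) (auto simp: U_def)
  also have "\<dots> \<le> (\<Sum>i<n. ennreal h)"
    by (intro sum_mono ennreal_leI diam)
  also have "\<dots> = ennreal (b - a)"
    using h by (simp add: ennreal_of_nat_eq_real_of_nat ennreal_mult[symmetric])
  finally show "hausdorff_content \<delta> (f ` {a..b}) \<le> ennreal (b - a)" .
qed

text \<open>A cover of \<open>A\<close> is carried by \<open>f\<close> to a cover of the interval
  whose members are no larger in diameter. Replacing these by their interval hulls, countable
  subadditivity of Lebesgue measure gives the bound.\<close>

lemma hausdorff_outer_ge_interval:
  fixes f :: "'a::metric_space \<Rightarrow> real"
  assumes f: "1-lipschitz_on UNIV f" and sub: "{a..b} \<subseteq> f ` A" and ab: "a \<le> b"
  shows "ennreal (b - a) \<le> hausdorff_outer A"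
proof -
  \<comment> \<open>The outer measure is a supremum over scales, so any single scale will do for a
    lower bound.\<close>
  have "ennreal (b - a) \<le> hausdorff_content 1 A"
    unfolding hausdorff_content_def
  proof (rule INF_greatest, clarify)
    fix U :: "nat \<Rightarrow> 'a set"
    assume cov: "A \<subseteq> (\<Union>i. U i)" and U: "\<forall>i. bounded (U i) \<and> diameter (U i) \<le> 1"
    define J where "J i = (if U i = {} then {} else {Inf (f ` U i)..Sup (f ` U i)})" for i
    have bdd: "bounded (f ` U i)" for i
    proof -
      obtain x e where "\<forall>y\<in>U i. dist x y \<le> e" using U unfolding bounded_def by blast
      then have "\<forall>y\<in>U i. dist (f x) (f y) \<le> e"
        using lipschitz_onD[OF f, of x] by (auto intro: order_trans)
      then show ?thesis unfolding bounded_def by blast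
    qed
    have J: "f ` U i \<subseteq> J i" for i
      using bdd[of i] by (auto simp: J_def intro!: cInf_lower cSup_upper bounded_imp_bdd_above bounded_imp_bdd_below)
    have le: "emeasure lborel (J i) \<le> ennreal (diameter (U i))" for i
    proof (cases "U i = {}")
      case False
      have "s - t \<le> diameter (U i)" if "s \<in> f ` U i" "t \<in> f ` U i" for s t
      proof -
        from that obtain x y where xy: "x \<in> U i" "y \<in> U i" "s = f x" "t = f y" by auto
        have "s - t \<le> dist (f x) (f y)" using xy by (simp add: dist_real_def)
        also have "\<dots> \<le> 1 * dist x y" by (rule lipschitz_onD[OF f]) auto
        also have "\<dots> \<le> diameter (U i)" using U xy by (simp add: diameter_bounded_bound)
        finally show ?thesis .
      qed
      then have "s \<le> diameter (U i) + t" if "s \<in> f ` U i" "t \<in> f ` U i" for s t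
        using that by (simp add: algebra_simps)
      then have "Sup (f ` U i) \<le> diameter (U i) + t" if "t \<in> f ` U i" for t
        using that False by (intro cSup_least) auto
      then have "Sup (f ` U i) - diameter (U i) \<le> Inf (f ` U i)"
        using False by (intro cInf_greatest) (auto simp: algebra_simps)
      moreover have "Inf (f ` U i) \<le> Sup (f ` U i)"
        using False J[of i] by (auto simp: J_def)
      ultimately show ?thesis using False by (simp add: J_def ennreal_leI)
    qed (simp add: J_def)
    have "{a..b} \<subseteq> (\<Union>i. J i)"
    proof
      fix t assume "t \<in> {a..b}"
      then obtain x where "x \<in> A" "t = f x" using sub by auto
      then show "t \<in> (\<Union>i. J i)" using cov J by blast
    qed
    then have "emeasure lborel {a..b} \<le> emeasure lborel (\<Union>i. J i)"
      by (rule emeasure_mono) (auto simp: J_def)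
    also have "\<dots> \<le> (\<Sum>i. emeasure lborel (J i))"
      by (rule emeasure_subadditive_countably) (auto simp: J_def)
    also have "\<dots> \<le> (\<Sum>i. ennreal (diameter (U i)))"
      by (intro suminf_le le) auto
    finally show "ennreal (b - a) \<le> (\<Sum>i. ennreal (diameter (U i)))"
      using ab by simp
  qed
  also have "\<dots> \<le> hausdorff_outer A"
    unfolding hausdorff_outer_def by (intro SUP_upper) auto
  finally show ?thesis .
qed

text \<open>The upper bound comes from the parametrisation by arc length, the lower bound from the
  projection onto the direction of the segment. Both maps are 1-Lipschitz.\<close>

lemma emeasure_hausdorff_closed_segment:
  fixes p q :: "'a::euclidean_space"
  shows "emeasure hausdorff (closed_segment p q) = ennreal (dist p q)"
proof -
  \<comment> \<open>Since \<open>sgn 0 = 0\<close>, the case \<open>p = q\<close> is included; this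
    is why only \<open>norm v \<le> 1\<close> is claimed.\<close>
  define v where "v = sgn (q - p)"
  have v: "norm v \<le> 1" "dist p q *\<^sub>R v = q - p" "dist p q * (v \<bullet> v) = dist p q"
    by (auto simp: v_def norm_sgn sgn_div_norm dist_norm norm_minus_commute dot_square_norm power2_eq_square divide_simps)
  have seg: "closed_segment p q = (\<lambda>t. p + t *\<^sub>R v) ` {0..dist p q}"
  proof -
    have "(\<lambda>t. p + t *\<^sub>R v) ` {0..dist p q} = (\<lambda>t. p + (dist p q * t) *\<^sub>R v) ` {0..1}"
    proof (cases "dist p q = 0")
      case False
      then have "{0..dist p q} = (\<lambda>t. dist p q * t) ` {0..1}"
        by (subst image_mult_atLeastAtMost) auto
      then show ?thesis by (simp only: image_image)
    qed (auto simp: image_constant_conv)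
    also have "\<dots> = closed_segment p q"
    proof -
      have "p + (dist p q * t) *\<^sub>R v = (1 - t) *\<^sub>R p + t *\<^sub>R q" for t
      proof -
        have "(dist p q * t) *\<^sub>R v = t *\<^sub>R (dist p q *\<^sub>R v)" by simp
        then show ?thesis unfolding v(2) by (simp add: algebra_simps)
      qed
      then show ?thesis by (simp add: closed_segment_image_interval)
    qed
    finally show ?thesis by simp
  qed
  have "hausdorff_outer (closed_segment p q) \<le> ennreal (dist p q - 0)"
    unfolding seg
  proof (rule hausdorff_outer_lipschitz_image_le)
    show "1-lipschitz_on {0..dist p q} (\<lambda>t. p + t *\<^sub>R v)"
    proof (rule lipschitz_onI)
      fix s t :: real
      have "dist (p + s *\<^sub>R v) (p + t *\<^sub>R v) = \<bar>s - t\<bar> * norm v"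
        by (simp add: dist_norm algebra_simps flip: scaleR_diff_left)
      also have "\<dots> \<le> \<bar>s - t\<bar> * 1" using v by (intro mult_left_mono) auto
      finally show "dist (p + s *\<^sub>R v) (p + t *\<^sub>R v) \<le> 1 * dist s t"
        by (simp add: dist_real_def)
    qed simp
  qed simp
  moreover have "ennreal (dist p q - 0) \<le> hausdorff_outer (closed_segment p q)"
  proof (rule hausdorff_outer_ge_interval)
    show "1-lipschitz_on UNIV (\<lambda>x. (x - p) \<bullet> v)"
    proof (rule lipschitz_onI)
      fix x y
      have "dist ((x - p) \<bullet> v) ((y - p) \<bullet> v) = \<bar>(x - y) \<bullet> v\<bar>"
        by (simp add: dist_real_def algebra_simps)
      also have "\<dots> \<le> norm (x - y) * norm v" by (rule Cauchy_Schwarz_ineq2)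
      also have "\<dots> \<le> norm (x - y) * 1" using v by (intro mult_left_mono) auto
      finally show "dist ((x - p) \<bullet> v) ((y - p) \<bullet> v) \<le> 1 * dist x y" by (simp add: dist_norm)
    qed simp
    show "{0..dist p q} \<subseteq> (\<lambda>x. (x - p) \<bullet> v) ` closed_segment p q"
      using v(3) by (cases "p = q") (auto simp: seg image_image)
  qed simp
  ultimately show ?thesis
    by (subst emeasure_hausdorff) (auto intro: antisym borel_closed)
qed

lemma null_sets_hausdorff_finite:
  fixes A :: "'a::euclidean_space set"
  assumes "finite A"
  shows "A \<in> null_sets hausdorff"
proof -
  have "(\<Union>x\<in>A. {x}) \<in> null_sets (hausdorff :: 'a measure)"
  proof (rule null_sets.finite_UN)
    show "{x} \<in> null_sets hausdorff" if "x \<in> A" for x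
      using emeasure_hausdorff_closed_segment[of x x] by (intro null_setsI) auto
  qed (use assms in auto)
  then show ?thesis by simp
qed

section \<open>Decompositions into segments and zonogons\<close>

text \<open>Two distinct common points put both segments on one line. Their union is then compact,
  connected and collinear, hence a segment.\<close>

lemma closed_segment_Un_infinite_Int:
  fixes a b c d :: "'a::euclidean_space"
  assumes inf: "infinite (closed_segment a b \<inter> closed_segment c d)"
  obtains p q where "p \<noteq> q" "closed_segment a b \<union> closed_segment c d = closed_segment p q"
proof -
  let ?I = "closed_segment a b \<inter> closed_segment c d"
  obtain x where x: "x \<in> ?I" using inf by (metis infinite_imp_nonempty ex_in_conv)
  obtain y where y: "y \<in> ?I" "y \<noteq> x"
    using infinite_remove[OF inf, of x] by (metis Diff_iff infinite_imp_nonempty ex_in_conv singletonI)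
  have col: "collinear (closed_segment a b \<union> closed_segment c d)"
  proof -
    have "z \<in> affine hull {x, y}" if z: "z \<in> closed_segment e f" and xy: "x \<in> closed_segment e f" "y \<in> closed_segment e f"
      for e f z
    proof -
      have "collinear {x, y, z}"
        using collinear_subset[OF collinear_closed_segment[of e f]] z xy by simp
      then show ?thesis using y(2) collinear_3_affine_hull by metis
    qed
    then have "closed_segment a b \<union> closed_segment c d \<subseteq> affine hull {x, y}"
      using x y by blast
    then show ?thesis unfolding collinear_affine_hull by blast
  qed
  have con: "connected (closed_segment a b \<union> closed_segment c d)"
    using x by (intro connected_Un) auto
  obtain p q where pq: "closed_segment a b \<union> closed_segment c d = closed_segment p q"
  proof (rule compact_convex_collinear_segment_alt[OF _ _ con col])
  qed (use x in \<open>auto intro: compact_Un\<close>)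
  moreover have "p \<noteq> q"
  proof
    assume "p = q"
    then have "closed_segment a b \<union> closed_segment c d = {p}" using pq by simp
    then have "closed_segment a b \<inter> closed_segment c d \<subseteq> {p}" by blast
    then show False using inf finite_subset by blast
  qed
  ultimately show ?thesis using that by blast
qed

text \<open>
  In a representation of \<open>B\<close> with the least number of segments, no two of them overlap: their union
  would be a single segment.
\<close>

lemma segment_decomposition_exists:
  assumes "finite_segment_union B"
  obtains S where "segment_decomposition S B"
proof -
  define P where "P S \<longleftrightarrow> nondegenerate_segments S \<and> B = (\<Union>(a, b)\<in>S. closed_segment a b)" for S
  have "\<exists>S. P S" using assms by (auto simp: P_def finite_segment_union_def)
  then obtain S where S: "P S" and min: "\<And>T. P T \<Longrightarrow> card S \<le> card T"
    using ex_has_least_nat[of P _ card] by blast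
  have fin: "finite S" using S by (simp add: P_def nondegenerate_segments_def)
  have "finite (closed_segment a b \<inter> closed_segment c d)"
    if ab: "(a, b) \<in> S" and cd: "(c, d) \<in> S" and ne: "(a, b) \<noteq> (c, d)" for a b c d
  proof (rule ccontr)
    assume "infinite (closed_segment a b \<inter> closed_segment c d)"
    then obtain p q where pq: "p \<noteq> q" "closed_segment a b \<union> closed_segment c d = closed_segment p q"
      by (rule closed_segment_Un_infinite_Int)
    let ?R = "S - {(a, b), (c, d)}"
    have SR: "S = insert (a, b) (insert (c, d) ?R)" using ab cd by blast
    have "(\<Union>(a, b)\<in>S. closed_segment a b) = (\<Union>(a, b)\<in>insert (p, q) ?R. closed_segment a b)"
      by (subst SR) (auto simp flip: pq(2))
    then have "P (insert (p, q) ?R)"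
      using S pq(1) by (auto simp: P_def nondegenerate_segments_def)
    moreover have "card (insert (p, q) ?R) < card S"
    proof -
      \<comment> \<open>Only an inequality, because \<open>(p, q)\<close> may already be among the
        remaining pairs.\<close>
      have "card (insert (p, q) ?R) \<le> Suc (card ?R)" by (rule card_insert_le_m1) auto
      moreover have "card S = Suc (Suc (card ?R))"
        by (subst SR) (use fin ne in \<open>simp add: card_insert_disjoint\<close>)
      ultimately show ?thesis by simp
    qed
    ultimately show False using min by (meson not_le)
  qed
  then have "segment_decomposition S B"
    using S by (fastforce simp: P_def segment_decomposition_def)
  then show ?thesis by (rule that)
qed

section \<open>Zonogons and their support functions\<close>

text \<open>Names the set under the definite description in \<open>convexification\<close>, so that
  it can be studied before its independence of the decomposition is known.\<close>

definition zonogon :: "((real^2) \<times> (real^2)) set \<Rightarrow> (real^2) set" where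
  "zonogon S = (\<Sum>(a, b)\<in>S. (\<lambda>x. x - midpoint a b) ` closed_segment a b)"

text \<open>Centring turns the point with parameter \<open>t\<close> into
  \<open>(t - 1/2) *\<^sub>R (b - a)\<close>, and \<open>t - 1/2\<close> has absolute value at most
  \<open>1/2\<close>. An endpoint attains the bound, so this is the support function of a centred
  segment.\<close>

lemma mem_centred_segment_inner_le:
  assumes "y \<in> (\<lambda>x. x - midpoint a b) ` closed_segment a b"
  shows "y \<bullet> u \<le> \<bar>(b - a) \<bullet> u\<bar> / 2"
proof -
  obtain x where x: "x \<in> closed_segment a b" "y = x - midpoint a b"
    using assms by blast
  obtain t where t: "0 \<le> t" "t \<le> 1" "x = (1 - t) *\<^sub>R a + t *\<^sub>R b"
    using x(1) unfolding in_segment by blast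
  then have "y \<bullet> u = (t - 1/2) * ((b - a) \<bullet> u)"
    unfolding x(2) t(3) by (simp add: midpoint_def inner_add_left inner_diff_left field_simps)
  also have "\<dots> \<le> \<bar>t - 1/2\<bar> * \<bar>(b - a) \<bullet> u\<bar>" by (metis abs_ge_self abs_mult)
  also have "\<dots> \<le> (1/2) * \<bar>(b - a) \<bullet> u\<bar>"
  proof (rule mult_right_mono)
    show "\<bar>t - 1/2\<bar> \<le> 1/2" using t(1,2) by arith
  qed simp
  finally show ?thesis by simp
qed

lemma centred_segment_inner_attained:
  obtains y where "y \<in> (\<lambda>x. x - midpoint a b) ` closed_segment a b" "y \<bullet> u = \<bar>(b - a) \<bullet> u\<bar> / 2"
proof -
  have "(a - midpoint a b) \<bullet> u = \<bar>(b - a) \<bullet> u\<bar> / 2 \<or> (b - midpoint a b) \<bullet> u = \<bar>(b - a) \<bullet> u\<bar> / 2"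
    by (simp add: midpoint_def inner_add_left inner_diff_left abs_if field_simps)
  then show ?thesis using that by auto
qed

lemma zonogon_insert:
  assumes "finite S" "(a, b) \<notin> S"
  shows "zonogon (insert (a, b) S) = (\<lambda>x. x - midpoint a b) ` closed_segment a b + zonogon S"
  using assms by (simp add: zonogon_def)

lemma compact_zonogon: "finite S \<Longrightarrow> compact (zonogon S)"
proof (induction S rule: finite_induct)
  case empty
  then show ?case by (simp add: zonogon_def)
next
  case (insert s S)
  obtain a b where s: "s = (a, b)" by force
  have "compact ((\<lambda>x. x - midpoint a b) ` closed_segment a b)"
    by (intro compact_continuous_image continuous_intros) auto
  from compact_sums[OF this insert.IH]
  have "compact ((\<lambda>x. x - midpoint a b) ` closed_segment a b + zonogon S)"
    by (rule back_subst) (auto simp only: set_plus_def)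
  then show ?case using insert.hyps by (simp add: s zonogon_insert)
qed

lemma convex_zonogon: "convex (zonogon S)"
  unfolding zonogon_def
  by (intro convex_set_sum) (auto intro!: convex_translation_subtract)

text \<open>Support functions add under Minkowski sums: upper bounds of the summands add up here,
  and sums of maximisers attain the total in \<open>zonogon_inner_attained\<close>.\<close>

lemma zonogon_inner_le:
  "finite S \<Longrightarrow> y \<in> zonogon S \<Longrightarrow> y \<bullet> u \<le> (\<Sum>(a, b)\<in>S. \<bar>(b - a) \<bullet> u\<bar>) / 2"
proof (induction S arbitrary: y rule: finite_induct)
  case empty
  then show ?case by (simp add: zonogon_def)
next
  case (insert s S)
  obtain a b where s: "s = (a, b)" by force
  obtain v w where vw: "v \<in> (\<lambda>x. x - midpoint a b) ` closed_segment a b" "w \<in> zonogon S" "y = v + w"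
    using insert.prems insert.hyps by (auto simp: s zonogon_insert elim!: set_plus_elim)
  have "v \<bullet> u + w \<bullet> u \<le> \<bar>(b - a) \<bullet> u\<bar> / 2 + (\<Sum>(a, b)\<in>S. \<bar>(b - a) \<bullet> u\<bar>) / 2"
    using mem_centred_segment_inner_le[OF vw(1)] insert.IH[OF vw(2)] by (intro add_mono)
  then show ?case using insert.hyps by (simp add: s vw(3) inner_add_left add_divide_distrib)
qed

lemma zonogon_inner_attained:
  "finite S \<Longrightarrow> \<exists>y\<in>zonogon S. y \<bullet> u = (\<Sum>(a, b)\<in>S. \<bar>(b - a) \<bullet> u\<bar>) / 2"
proof (induction S rule: finite_induct)
  case empty
  show ?case by (rule bexI[of _ 0]) (simp_all add: zonogon_def set_zero)
next
  case (insert s S)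
  obtain a b where s: "s = (a, b)" by force
  obtain v where v: "v \<in> (\<lambda>x. x - midpoint a b) ` closed_segment a b" "v \<bullet> u = \<bar>(b - a) \<bullet> u\<bar> / 2"
    by (rule centred_segment_inner_attained)
  obtain w where w: "w \<in> zonogon S" "w \<bullet> u = (\<Sum>(a, b)\<in>S. \<bar>(b - a) \<bullet> u\<bar>) / 2"
    using insert.IH by blast
  have "v + w \<in> zonogon (insert s S)"
    using v w insert.hyps by (auto simp: s zonogon_insert intro: set_plus_intro)
  moreover have "(v + w) \<bullet> u = (\<Sum>(a, b)\<in>insert s S. \<bar>(b - a) \<bullet> u\<bar>) / 2"
    using insert.hyps v w by (simp add: s inner_add_left add_divide_distrib)
  ultimately show ?case by blast
qed

text \<open>A closed convex set is the intersection of its supporting half-planes. A point outside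
  would be strictly separated by some \<open>v\<close>, contradicting the inequality in direction
  \<open>- v\<close>.\<close>

lemma mem_zonogon_iff:
  assumes "finite S"
  shows "y \<in> zonogon S \<longleftrightarrow> (\<forall>u. y \<bullet> u \<le> (\<Sum>(a, b)\<in>S. \<bar>(b - a) \<bullet> u\<bar>) / 2)"
proof
  assume R: "\<forall>u. y \<bullet> u \<le> (\<Sum>(a, b)\<in>S. \<bar>(b - a) \<bullet> u\<bar>) / 2"
  show "y \<in> zonogon S"
  proof (rule ccontr)
    assume "y \<notin> zonogon S"
    then obtain v \<beta> where v: "v \<bullet> y < \<beta>" "\<And>z. z \<in> zonogon S \<Longrightarrow> \<beta> < v \<bullet> z"
      using separating_hyperplane_closed_point[OF convex_zonogon compact_imp_closed[OF compact_zonogon[OF assms]]]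
      by blast
    obtain z where z: "z \<in> zonogon S" "z \<bullet> (- v) = (\<Sum>(a, b)\<in>S. \<bar>(b - a) \<bullet> (- v)\<bar>) / 2"
      using zonogon_inner_attained[OF assms] by blast
    have "y \<bullet> (- v) \<le> z \<bullet> (- v)" using R z(2) by metis
    then show False using v(1) v(2)[OF z(1)] by (simp add: inner_commute)
  qed
qed (use zonogon_inner_le[OF assms] in blast)

section \<open>Projections onto lines\<close>

text \<open>This is the exceptional set off which the segments are pairwise disjoint. Being finite,
  it and its projections are null sets.\<close>

lemma finite_overlaps:
  assumes "segment_decomposition S B"
  shows "finite (\<Union>s\<in>S. \<Union>t\<in>S - {s}.
    (case s of (a, b) \<Rightarrow> closed_segment a b) \<inter> (case t of (a, b) \<Rightarrow> closed_segment a b))"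
proof -
  have *: "\<forall>(a, b)\<in>S. \<forall>(c, d)\<in>S. (a, b) \<noteq> (c, d) \<longrightarrow> finite (closed_segment a b \<inter> closed_segment c d)"
    using assms unfolding segment_decomposition_def by (elim conjE)
  have "finite (closed_segment a b \<inter> closed_segment c d)"
    if "(a, b) \<in> S" "(c, d) \<in> S" "(a, b) \<noteq> (c, d)" for a b c d
    using bspec[OF bspec[OF * that(1), simplified] that(2)] that(3) by simp
  moreover have "finite S"
    using assms by (simp add: segment_decomposition_def nondegenerate_segments_def)
  ultimately show ?thesis by (intro finite_UN_I finite_Diff) auto
qed

text \<open>Off a finite set the indicator of \<open>B\<close> is the sum of the indicators of the
  segments; integrating this identity adds up their lengths.\<close>

lemma emeasure_hausdorff_segment_decomposition:
  assumes S: "segment_decomposition S B"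
  shows "emeasure hausdorff B = ennreal (\<Sum>(a, b)\<in>S. dist a b)"
proof -
  define g :: "(real^2) \<times> (real^2) \<Rightarrow> (real^2) set" where "g = (\<lambda>(a, b). closed_segment a b)"
  define N where "N = (\<Union>s\<in>S. \<Union>t\<in>S - {s}. g s \<inter> g t)"
  have fin: "finite S" using S by (simp add: segment_decomposition_def nondegenerate_segments_def)
  have B: "B = (\<Union>s\<in>S. g s)" using S by (auto simp: segment_decomposition_def g_def)
  have N: "N \<in> null_sets hausdorff"
    unfolding N_def g_def by (intro null_sets_hausdorff_finite finite_overlaps[OF S])
  have meas: "g s \<in> sets borel" for s
    by (cases s) (auto simp: g_def borel_closed)
  have eq: "indicator B x = (\<Sum>s\<in>S. indicator (g s) x :: ennreal)" if "x \<notin> N" for x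
  proof -
    have "disjoint_family_on (\<lambda>s. g s - N) S" by (auto simp: disjoint_family_on_def N_def)
    with fin have "indicator (\<Union>s\<in>S. g s - N) x = (\<Sum>s\<in>S. indicator (g s - N) x :: ennreal)"
      by (rule indicator_UN_disjoint)
    then show ?thesis using that by (simp add: B indicator_def)
  qed
  have "emeasure hausdorff B = (\<integral>\<^sup>+x. indicator B x \<partial>hausdorff)"
    using fin meas by (subst nn_integral_indicator) (auto simp: B)
  also have "\<dots> = (\<integral>\<^sup>+x. (\<Sum>s\<in>S. indicator (g s) x) \<partial>hausdorff)"
    by (intro nn_integral_cong_AE AE_I'[OF N]) (use eq in auto)
  also have "\<dots> = (\<Sum>s\<in>S. emeasure hausdorff (g s))"
    using meas by (simp add: nn_integral_sum)
  also have "\<dots> = (\<Sum>s\<in>S. ennreal (case s of (a, b) \<Rightarrow> dist a b))"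
    by (intro sum.cong) (auto simp: g_def emeasure_hausdorff_closed_segment)
  also have "\<dots> = ennreal (\<Sum>(a, b)\<in>S. dist a b)"
    by (intro sum_ennreal) auto
  finally show ?thesis .
qed

lemma line_through_origin_iff: "line_through_origin g \<longleftrightarrow> (\<exists>u. norm u = 1 \<and> g = span {u})"
proof
  assume g: "line_through_origin g"
  then obtain b where b: "b \<subseteq> g" "independent b" "g \<subseteq> span b" "card b = 1"
    unfolding line_through_origin_def by (metis basis_exists)
  then obtain v where v: "b = {v}" by (meson card_1_singletonE)
  then have v0: "v \<noteq> 0" using b by auto
  have "g = span {v}"
    using b v g by (metis line_through_origin_def span_minimal subset_antisym)
  also have "span {v} = span {sgn v}"
    using v0 by (simp add: sgn_div_norm span_image_scale[of "{v}" "\<lambda>_. inverse (norm v)", simplified])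
  finally show "\<exists>u. norm u = 1 \<and> g = span {u}" using v0 norm_sgn by metis
next
  assume "\<exists>u. norm u = 1 \<and> g = span {u}"
  then show "line_through_origin g"
    by (auto simp: line_through_origin_def dim_span dim_singleton)
qed

section \<open>The line spanned by a fixed unit vector\<close>

context
  fixes u :: "real^2"
  assumes u: "norm u = 1"
begin

lemma inner_self_unit: "u \<bullet> u = 1"
  using u by (simp add: dot_square_norm)

lemma mem_span_unit_iff: "x \<in> span {u} \<longleftrightarrow> x = (x \<bullet> u) *\<^sub>R u"
  by (auto simp: span_singleton inner_self_unit)

lemma mem_orthogonal_comp_span_unit: "x \<in> orthogonal_comp (span {u}) \<longleftrightarrow> x \<bullet> u = 0"
  by (auto simp: orthogonal_comp_def orthogonal_def span_singleton inner_commute)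

text \<open>Turns the fibres in the definition of \<open>total_projection_length\<close> into level
  sets of the inner product with \<open>u\<close>.\<close>

lemma translated_orthogonal_comp: "(+) x ` orthogonal_comp (span {u}) = {y. y \<bullet> u = x \<bullet> u}"
proof -
  have "y \<in> (+) x ` orthogonal_comp (span {u}) \<longleftrightarrow> y \<bullet> u = x \<bullet> u" for y
  proof
    assume "y \<bullet> u = x \<bullet> u"
    then have "y - x \<in> orthogonal_comp (span {u})" "y = x + (y - x)"
      by (auto simp: mem_orthogonal_comp_span_unit inner_diff_left)
    then show "y \<in> (+) x ` orthogonal_comp (span {u})" by blast
  qed (auto simp: mem_orthogonal_comp_span_unit inner_add_left)
  then show ?thesis by blast
qed

lemma dist_scaleR_unit: "dist (s *\<^sub>R u) (t *\<^sub>R u) = \<bar>s - t\<bar>"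
  using u by (simp add: dist_norm flip: scaleR_diff_left)

lemma closed_segment_scaleR_unit:
  "closed_segment (s *\<^sub>R u) (t *\<^sub>R u) = (\<lambda>r. r *\<^sub>R u) ` closed_segment s t"
  by (rule closed_segment_linear_image[of "\<lambda>r. r *\<^sub>R u"]) (simp add: linear_iff scaleR_add_left)

lemma mem_closed_segment_scaleR_unit:
  "x \<in> closed_segment (s *\<^sub>R u) (t *\<^sub>R u) \<longleftrightarrow> x \<in> span {u} \<and> x \<bullet> u \<in> closed_segment s t"
  by (auto simp: closed_segment_scaleR_unit mem_span_unit_iff inner_self_unit)

lemma inner_image_closed_segment: "(\<lambda>x. x \<bullet> u) ` closed_segment a b = closed_segment (a \<bullet> u) (b \<bullet> u)"
  by (rule closed_segment_linear_image[of "\<lambda>x. x \<bullet> u", symmetric]) (simp add: linear_iff inner_add_left)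

text \<open>The inner product with \<open>u\<close> is injective along a segment that is not
  orthogonal to \<open>u\<close>, so a fibre meets the segment once or not at all, according to
  whether \<open>x\<close> lies in the projected segment.\<close>

lemma emeasure_segment_Int_perp:
  assumes ab: "a \<bullet> u \<noteq> b \<bullet> u" and x: "x \<in> span {u}"
  shows "emeasure (count_space UNIV) (closed_segment a b \<inter> {y. y \<bullet> u = x \<bullet> u})
    = indicator (closed_segment ((a \<bullet> u) *\<^sub>R u) ((b \<bullet> u) *\<^sub>R u)) x"
proof (cases "x \<bullet> u \<in> closed_segment (a \<bullet> u) (b \<bullet> u)")
  case True
  then have "x \<bullet> u \<in> (\<lambda>x. x \<bullet> u) ` closed_segment a b"
    by (simp only: inner_image_closed_segment)
  then obtain y where y: "y \<in> closed_segment a b" "y \<bullet> u = x \<bullet> u" by auto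
  have "z = y" if z: "z \<in> closed_segment a b" "z \<bullet> u = x \<bullet> u" for z
  proof -
    obtain s where s: "z = (1 - s) *\<^sub>R a + s *\<^sub>R b" using z(1) unfolding in_segment by blast
    obtain t where t: "y = (1 - t) *\<^sub>R a + t *\<^sub>R b" using y(1) unfolding in_segment by blast
    have "(s - t) * (b \<bullet> u - a \<bullet> u) = z \<bullet> u - y \<bullet> u"
      by (simp add: s t inner_add_left algebra_simps)
    then have "s = t" using ab y(2) z(2) by simp
    then show ?thesis using s t by simp
  qed
  then have "closed_segment a b \<inter> {y. y \<bullet> u = x \<bullet> u} = {y}" using y by blast
  then show ?thesis using True x by (simp add: mem_closed_segment_scaleR_unit)
next
  case False
  then have "x \<bullet> u \<notin> (\<lambda>x. x \<bullet> u) ` closed_segment a b"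
    by (simp only: inner_image_closed_segment not_False_eq_True)
  then have "closed_segment a b \<inter> {y. y \<bullet> u = x \<bullet> u} = {}" by (auto simp: image_iff)
  then show ?thesis using False by (simp add: mem_closed_segment_scaleR_unit)
qed

text \<open>Over almost every point of the line the fibre of \<open>B\<close> splits into disjoint
  fibres of the segments, so the multiplicity is a sum of indicators of projected segments, whose
  lengths are known.\<close>

lemma total_projection_length_segment_decomposition:
  assumes S: "segment_decomposition S B"
  shows "total_projection_length B (span {u}) = ennreal (\<Sum>(a, b)\<in>S. \<bar>(b - a) \<bullet> u\<bar>)"
proof -
  define g :: "(real^2) \<times> (real^2) \<Rightarrow> (real^2) set" where "g = (\<lambda>(a, b). closed_segment a b)"
  define P where "P = (\<lambda>(a, b). closed_segment ((a \<bullet> u) *\<^sub>R u) ((b \<bullet> u) *\<^sub>R u))"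
  \<comment> \<open>Off \<open>N\<close>, a line orthogonal to \<open>u\<close> meets no two segments in a common point, and it contains no segment.\<close>
  define N where "N = (\<lambda>z. (z \<bullet> u) *\<^sub>R u) ` (\<Union>s\<in>S. \<Union>t\<in>S - {s}. g s \<inter> g t)
    \<union> (\<lambda>(a, b). (a \<bullet> u) *\<^sub>R u) ` S"
  have fin: "finite S" using S by (simp add: segment_decomposition_def nondegenerate_segments_def)
  have B: "B = (\<Union>s\<in>S. g s)" using S by (auto simp: segment_decomposition_def g_def)
  have N: "N \<in> null_sets hausdorff"
    unfolding N_def g_def
    by (intro null_sets_hausdorff_finite finite_UnI finite_imageI finite_overlaps[OF S] fin)
  have meas: "P s \<in> sets borel" for s
    by (cases s) (auto simp: P_def borel_closed)
  have eq: "emeasure (count_space UNIV) (B \<inter> (+) x ` orthogonal_comp (span {u})) * indicator (span {u}) x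
      = (\<Sum>s\<in>S. indicator (P s) x)" if x: "x \<notin> N" for x
  proof (cases "x \<in> span {u}")
    case False
    then have "x \<notin> P s" for s by (cases s) (simp add: P_def mem_closed_segment_scaleR_unit)
    then show ?thesis using False by simp
  next
    case True
    let ?L = "{y. y \<bullet> u = x \<bullet> u}"
    have xN: "z \<bullet> u \<noteq> x \<bullet> u" if "z \<in> g s" "z \<in> g t" "s \<in> S" "t \<in> S" "s \<noteq> t" for z s t
    proof
      assume "z \<bullet> u = x \<bullet> u"
      then have "x = (z \<bullet> u) *\<^sub>R u" using True mem_span_unit_iff[of x] by simp
      then have "x \<in> N" using that unfolding N_def by blast
      then show False using x by simp
    qed
    have one: "emeasure (count_space UNIV) (g s \<inter> ?L) = indicator (P s) x" if s: "s \<in> S" for s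
    proof -
      obtain a b where ab: "s = (a, b)" by force
      have ax: "a \<bullet> u \<noteq> x \<bullet> u"
      proof
        assume "a \<bullet> u = x \<bullet> u"
        then have "x = (\<lambda>(a, b). (a \<bullet> u) *\<^sub>R u) s" using True mem_span_unit_iff[of x] by (simp add: ab)
        then have "x \<in> N" using s unfolding N_def by blast
        then show False using x by simp
      qed
      show ?thesis
      proof (cases "a \<bullet> u = b \<bullet> u")
        case False
        then show ?thesis using emeasure_segment_Int_perp True by (simp add: ab g_def P_def)
      next
        \<comment> \<open>A segment orthogonal to \<open>u\<close> projects to one point, which lies
          in \<open>N\<close>; hence both sides vanish.\<close>
        case eq: True
        have "y \<bullet> u \<noteq> x \<bullet> u" if "y \<in> closed_segment a b" for y
        proof -
          have "y \<bullet> u \<in> closed_segment (a \<bullet> u) (b \<bullet> u)"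
            using that unfolding inner_image_closed_segment[symmetric] by (rule imageI)
          then show ?thesis using eq ax by simp
        qed
        then have "g s \<inter> ?L = {}" by (auto simp: g_def ab)
        moreover have "x \<notin> P s"
          using ax eq mem_closed_segment_scaleR_unit[of x "a \<bullet> u" "b \<bullet> u"] by (simp add: P_def ab)
        ultimately show ?thesis by simp
      qed
    qed
    have "B \<inter> ?L = (\<Union>s\<in>S. g s \<inter> ?L)" unfolding B by blast
    also have "emeasure (count_space UNIV) \<dots> = (\<Sum>s\<in>S. emeasure (count_space UNIV) (g s \<inter> ?L))"
    proof (rule sum_emeasure[symmetric])
      show "disjoint_family_on (\<lambda>s. g s \<inter> ?L) S"
        unfolding disjoint_family_on_def using xN by blast
    qed (use fin in auto)
    finally have "emeasure (count_space UNIV) (B \<inter> ?L) = (\<Sum>s\<in>S. indicator (P s) x)"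
      using one by (simp only: cong: sum.cong)
    then show ?thesis using True by (simp only: translated_orthogonal_comp indicator_simps mult_1_right)
  qed
  have "total_projection_length B (span {u}) = (\<integral>\<^sup>+x. (\<Sum>s\<in>S. indicator (P s) x) \<partial>hausdorff)"
    unfolding total_projection_length_def
    by (intro nn_integral_cong_AE AE_I'[OF N]) (use eq in auto)
  also have "\<dots> = (\<Sum>s\<in>S. emeasure hausdorff (P s))"
    using meas by (simp add: nn_integral_sum)
  also have "\<dots> = (\<Sum>s\<in>S. ennreal (case s of (a, b) \<Rightarrow> \<bar>(b - a) \<bullet> u\<bar>))"
    by (intro sum.cong)
      (auto simp: P_def emeasure_hausdorff_closed_segment dist_scaleR_unit u inner_diff_left abs_minus_commute)
  also have "\<dots> = ennreal (\<Sum>(a, b)\<in>S. \<bar>(b - a) \<bullet> u\<bar>)"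
    by (intro sum_ennreal) auto
  finally show ?thesis .
qed

text \<open>By convexity the segment from \<open>l\<close> to \<open>k\<close> lies in
  \<open>K\<close>, and its projection already covers every value between the two extremes.\<close>

lemma emeasure_orthogonal_projection:
  assumes K: "convex K" "k \<in> K" "l \<in> K" and kl: "\<And>z. z \<in> K \<Longrightarrow> l \<bullet> u \<le> z \<bullet> u \<and> z \<bullet> u \<le> k \<bullet> u"
  shows "emeasure hausdorff (orthogonal_projection (span {u}) K) = ennreal ((k - l) \<bullet> u)"
proof -
  have "x \<in> orthogonal_projection (span {u}) K \<longleftrightarrow> x \<in> closed_segment ((l \<bullet> u) *\<^sub>R u) ((k \<bullet> u) *\<^sub>R u)" for x
  proof -
    have "x \<in> orthogonal_projection (span {u}) K \<longleftrightarrow> x \<in> span {u} \<and> x \<bullet> u \<in> (\<lambda>z. z \<bullet> u) ` K"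
      by (auto simp: orthogonal_projection_def mem_orthogonal_comp_span_unit inner_diff_left intro: rev_image_eqI)
    also have "(\<lambda>z. z \<bullet> u) ` K = closed_segment (l \<bullet> u) (k \<bullet> u)"
    proof
      show "(\<lambda>z. z \<bullet> u) ` K \<subseteq> closed_segment (l \<bullet> u) (k \<bullet> u)"
        using kl kl[OF K(2)] by (auto simp: closed_segment_eq_real_ivl)
      show "closed_segment (l \<bullet> u) (k \<bullet> u) \<subseteq> (\<lambda>z. z \<bullet> u) ` K"
        unfolding inner_image_closed_segment[symmetric]
        using K by (intro image_mono closed_segment_subset)
    qed
    finally show ?thesis by (simp add: mem_closed_segment_scaleR_unit)
  qed
  then have "orthogonal_projection (span {u}) K = closed_segment ((l \<bullet> u) *\<^sub>R u) ((k \<bullet> u) *\<^sub>R u)"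
    by blast
  then show ?thesis
    using kl[OF K(2)] by (simp add: emeasure_hausdorff_closed_segment dist_scaleR_unit u inner_diff_left abs_if)
qed

end

text \<open>The projection of \<open>K\<close> has length \<open>(k - l) \<bullet> u\<close> for
  extremal \<open>k\<close> and \<open>l\<close>; quantifying over all pairs avoids choosing them.
  Both sides of the inequality scale with the norm of \<open>u\<close>, so unit vectors may be
  replaced by arbitrary ones.\<close>

lemma weak_barrier_iff:
  assumes S: "segment_decomposition S B" and K: "convex_body K"
  shows "weak_barrier B K \<longleftrightarrow> (\<forall>k\<in>K. \<forall>l\<in>K. \<forall>u. (k - l) \<bullet> u \<le> (\<Sum>(a, b)\<in>S. \<bar>(b - a) \<bullet> u\<bar>))"
    (is "_ \<longleftrightarrow> ?R")
proof -
  have K': "convex K" "compact K" "K \<noteq> {}" using K by (auto simp: convex_body_def)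
  have extremes: "\<exists>k\<in>K. \<exists>l\<in>K. \<forall>z\<in>K. l \<bullet> u \<le> z \<bullet> u \<and> z \<bullet> u \<le> k \<bullet> u" for u :: "real^2"
  proof -
    have c: "continuous_on K (\<lambda>z. z \<bullet> u)" by (intro continuous_intros)
    show ?thesis
      using continuous_attains_sup[OF K'(2,3) c] continuous_attains_inf[OF K'(2,3) c] by blast
  qed
  have line: "emeasure hausdorff (orthogonal_projection (span {u}) K) \<le> total_projection_length B (span {u})
      \<longleftrightarrow> (\<forall>k\<in>K. \<forall>l\<in>K. (k - l) \<bullet> u \<le> (\<Sum>(a, b)\<in>S. \<bar>(b - a) \<bullet> u\<bar>))"
    if u: "norm u = 1" for u
  proof -
    obtain k l where kl: "k \<in> K" "l \<in> K" "\<And>z. z \<in> K \<Longrightarrow> l \<bullet> u \<le> z \<bullet> u \<and> z \<bullet> u \<le> k \<bullet> u"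
      using extremes[of u] by blast
    have width: "(k' - l') \<bullet> u \<le> (k - l) \<bullet> u" if "k' \<in> K" "l' \<in> K" for k' l'
      using kl(3)[OF that(1)] kl(3)[OF that(2)] by (simp add: inner_diff_left)
    have nonneg: "0 \<le> (\<Sum>(a, b)\<in>S. \<bar>(b - a) \<bullet> u\<bar>)" by (intro sum_nonneg) auto
    have "emeasure hausdorff (orthogonal_projection (span {u}) K) = ennreal ((k - l) \<bullet> u)"
      using kl(3) by (intro emeasure_orthogonal_projection[OF u K'(1) kl(1,2)])
    then have "emeasure hausdorff (orthogonal_projection (span {u}) K) \<le> total_projection_length B (span {u})
      \<longleftrightarrow> (k - l) \<bullet> u \<le> (\<Sum>(a, b)\<in>S. \<bar>(b - a) \<bullet> u\<bar>)"
      by (simp only: total_projection_length_segment_decomposition[OF u S] ennreal_le_iff[OF nonneg])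
    also have "\<dots> \<longleftrightarrow> (\<forall>k\<in>K. \<forall>l\<in>K. (k - l) \<bullet> u \<le> (\<Sum>(a, b)\<in>S. \<bar>(b - a) \<bullet> u\<bar>))"
      using kl(1,2) width by (blast intro: order_trans)
    finally show ?thesis .
  qed
  show ?thesis
  proof
    assume ?R
    then show "weak_barrier B K" using line by (auto simp: weak_barrier_def line_through_origin_iff)
  next
    assume W: "weak_barrier B K"
    show ?R
    proof (intro ballI allI)
      fix k l and u :: "real^2" assume kl: "k \<in> K" "l \<in> K"
      show "(k - l) \<bullet> u \<le> (\<Sum>(a, b)\<in>S. \<bar>(b - a) \<bullet> u\<bar>)"
      proof (cases "u = 0")
        case True
        then show ?thesis by (simp add: case_prod_unfold)
      next
        case False
        then have n: "norm (sgn u) = 1" by (simp add: norm_sgn)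
        then have "(k - l) \<bullet> sgn u \<le> (\<Sum>(a, b)\<in>S. \<bar>(b - a) \<bullet> sgn u\<bar>)"
          using W line[OF n] kl by (auto simp: weak_barrier_def line_through_origin_iff)
        then have "norm u * ((k - l) \<bullet> sgn u) \<le> norm u * (\<Sum>(a, b)\<in>S. \<bar>(b - a) \<bullet> sgn u\<bar>)"
          by (intro mult_left_mono) auto
        moreover have s: "norm u * (x \<bullet> sgn u) = x \<bullet> u" for x
          using False by (simp add: sgn_div_norm)
        moreover have "norm u * \<bar>x \<bullet> sgn u\<bar> = \<bar>x \<bullet> u\<bar>" for x
          unfolding s[symmetric, of x] by (simp add: abs_mult)
        ultimately show ?thesis
          by (simp add: sum_distrib_left case_prod_unfold)
      qed
    qed
  qed
qed

text \<open>For unit vectors both sums are the total projection length, which depends on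
  \<open>B\<close> alone; homogeneity does the rest.\<close>

lemma projection_sum_eq:
  assumes S: "segment_decomposition S B" and T: "segment_decomposition T B"
  shows "(\<Sum>(a, b)\<in>S. \<bar>(b - a) \<bullet> u\<bar>) = (\<Sum>(a, b)\<in>T. \<bar>(b - a) \<bullet> u\<bar>)"
proof (cases "u = 0")
  case False
  then have n: "norm (sgn u) = 1" by (simp add: norm_sgn)
  have s: "(\<Sum>(a, b)\<in>S. \<bar>(b - a) \<bullet> u\<bar>) = norm u * (\<Sum>(a, b)\<in>S. \<bar>(b - a) \<bullet> sgn u\<bar>)" for S
  proof -
    have "\<bar>x \<bullet> u\<bar> = norm u * \<bar>x \<bullet> sgn u\<bar>" for x
      using False by (simp add: sgn_div_norm abs_mult)
    then show ?thesis by (simp add: sum_distrib_left case_prod_unfold)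
  qed
  have "ennreal (\<Sum>(a, b)\<in>S. \<bar>(b - a) \<bullet> sgn u\<bar>) = ennreal (\<Sum>(a, b)\<in>T. \<bar>(b - a) \<bullet> sgn u\<bar>)"
    using total_projection_length_segment_decomposition[OF n S]
      total_projection_length_segment_decomposition[OF n T] by simp
  then have "(\<Sum>(a, b)\<in>S. \<bar>(b - a) \<bullet> sgn u\<bar>) = (\<Sum>(a, b)\<in>T. \<bar>(b - a) \<bullet> sgn u\<bar>)"
    by (subst (asm) ennreal_inj) (auto intro!: sum_nonneg)
  then show ?thesis by (simp add: s)
qed (simp add: case_prod_unfold)

text \<open>Zonogons of two decompositions have the same support function, hence coincide, which
  makes the definite description meaningful.\<close>

lemma convexification_eq_zonogon:
  assumes S: "segment_decomposition S B"
  shows "convexification B = zonogon S"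
proof -
  have "zonogon T = zonogon S" if T: "segment_decomposition T B" for T
  proof -
    have "finite S" "finite T"
      using S T by (auto simp: segment_decomposition_def nondegenerate_segments_def)
    then show ?thesis by (auto simp: mem_zonogon_iff projection_sum_eq[OF T S])
  qed
  then show ?thesis
    unfolding convexification_def zonogon_def[symmetric] using S by (intro the_equality) blast+
qed

text \<open>The points of the Blaschke body are the halved differences \<open>k - l\<close>, and
  their factor cancels against the one in the support function of the zonogon.\<close>

lemma blaschke_body_subset_zonogon_iff:
  assumes "finite S"
  shows "blaschke_body K \<subseteq> zonogon S
    \<longleftrightarrow> (\<forall>k\<in>K. \<forall>l\<in>K. \<forall>u. (k - l) \<bullet> u \<le> (\<Sum>(a, b)\<in>S. \<bar>(b - a) \<bullet> u\<bar>))"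
proof -
  have "blaschke_body K = (\<Union>k\<in>K. \<Union>l\<in>K. {(1/2) *\<^sub>R (k - l)})"
    by (auto simp: blaschke_body_def set_plus_def image_iff)
  then show ?thesis using assms by (simp add: UN_subset_iff mem_zonogon_iff)
qed

section \<open>Polygons circumscribed to a convex body\<close>

definition dir :: "real \<Rightarrow> real^2" where
  "dir \<theta> = vector [cos \<theta>, sin \<theta>]"

lemma inner_dir: "x \<bullet> dir \<theta> = x $ 1 * cos \<theta> + x $ 2 * sin \<theta>"
  by (simp add: dir_def inner_vec_def sum_2)

lemma norm_dir: "norm (dir \<theta>) = 1"
  by (simp add: norm_eq_1 inner_dir) (simp add: dir_def flip: power2_eq_square)

lemma dir_add: "dir (\<theta> + t) = cos t *\<^sub>R dir \<theta> + sin t *\<^sub>R dir (\<theta> + pi/2)"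
  by (simp add: dir_def vec_eq_iff forall_2 cos_add sin_add algebra_simps)

lemma dir_diff: "dir (\<theta> - t) = cos t *\<^sub>R dir \<theta> - sin t *\<^sub>R dir (\<theta> + pi/2)"
  using dir_add[of \<theta> "- t"] by simp

lemma dir_add_pi: "dir (\<theta> + pi) = - dir \<theta>"
  by (simp add: dir_def vec_eq_iff forall_2)

lemma dir_orthonormal_expansion: "y = (y \<bullet> dir \<theta>) *\<^sub>R dir \<theta> + (y \<bullet> dir (\<theta> + pi/2)) *\<^sub>R dir (\<theta> + pi/2)"
proof -
  have "a = (a * cos \<theta> + b * sin \<theta>) * cos \<theta> + (b * cos \<theta> - a * sin \<theta>) * - sin \<theta>" for a b
  proof -
    have "(a * cos \<theta> + b * sin \<theta>) * cos \<theta> + (b * cos \<theta> - a * sin \<theta>) * - sin \<theta>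
        = a * ((sin \<theta>)\<^sup>2 + (cos \<theta>)\<^sup>2)"
      by algebra
    then show ?thesis by simp
  qed
  moreover have "b = (a * cos \<theta> + b * sin \<theta>) * sin \<theta> + (b * cos \<theta> - a * sin \<theta>) * cos \<theta>" for a b
  proof -
    have "(a * cos \<theta> + b * sin \<theta>) * sin \<theta> + (b * cos \<theta> - a * sin \<theta>) * cos \<theta>
        = b * ((sin \<theta>)\<^sup>2 + (cos \<theta>)\<^sup>2)"
      by algebra
    then show ?thesis by simp
  qed
  ultimately show ?thesis
    by (simp add: vec_eq_iff forall_2 inner_dir) (simp add: dir_def cos_add sin_add)
qed

lemma polar_form:
  fixes x :: "real^2"
  obtains \<phi> where "x = norm x *\<^sub>R dir \<phi>"
proof (cases "x = 0")
  case True
  then show ?thesis using that by simp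
next
  case False
  have "(x $ 1)\<^sup>2 + (x $ 2)\<^sup>2 = (norm x)\<^sup>2"
    unfolding power2_norm_eq_inner by (simp add: inner_vec_def sum_2 power2_eq_square)
  then have "(x $ 1 / norm x)\<^sup>2 + (x $ 2 / norm x)\<^sup>2 = 1"
    using False by (simp add: power_divide flip: add_divide_distrib)
  then obtain \<phi> where "x $ 1 / norm x = cos \<phi>" "x $ 2 / norm x = sin \<phi>"
    using sincos_total_2pi by metis
  then have "x $ 1 = norm x * cos \<phi>" "x $ 2 = norm x * sin \<phi>"
    using False by (simp_all add: divide_eq_eq mult.commute)
  then have "x = norm x *\<^sub>R dir \<phi>"
    unfolding vec_eq_iff forall_2 by (simp add: dir_def)
  then show ?thesis by (rule that)
qed

lemma inner_dir_dir: "dir \<phi> \<bullet> dir \<theta> = cos (\<theta> - \<phi>)"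
  by (simp add: inner_dir cos_diff) (simp add: dir_def)

section \<open>Support functions, nearest points and outer normals\<close>

definition support_function :: "'a::real_inner set \<Rightarrow> 'a \<Rightarrow> real" where
  "support_function K u = (SUP x\<in>K. x \<bullet> u)"

lemma support_function_attained:
  assumes "compact K" "K \<noteq> {}"
  obtains x where "x \<in> K" "support_function K u = x \<bullet> u"
proof -
  have "continuous_on K (\<lambda>x. x \<bullet> u)" by (intro continuous_intros)
  then obtain x where x: "x \<in> K" "\<And>y. y \<in> K \<Longrightarrow> y \<bullet> u \<le> x \<bullet> u"
    using continuous_attains_sup[OF assms] by blast
  have "support_function K u = x \<bullet> u"
    unfolding support_function_def using x by (intro cSup_eq_maximum) auto
  with x(1) show ?thesis by (rule that)
qed

lemma inner_le_support_function:
  assumes "compact K" "x \<in> K"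
  shows "x \<bullet> u \<le> support_function K u"
proof -
  have "compact ((\<lambda>x. x \<bullet> u) ` K)"
    by (intro compact_continuous_image continuous_intros assms)
  then have "bdd_above ((\<lambda>x. x \<bullet> u) ` K)"
    by (intro bounded_imp_bdd_above compact_imp_bounded)
  then show ?thesis unfolding support_function_def using assms(2) by (rule cSUP_upper2) simp
qed

text \<open>Expanding the squared distance to \<open>z\<close> leaves the squared norm of
  \<open>s *\<^sub>R v\<close> plus two terms, nonnegative because \<open>v\<close> is an outer
  normal at \<open>x\<close>.\<close>

lemma closest_point_outer_normal:
  fixes K :: "'a::euclidean_space set"
  assumes K: "convex K" "closed K" and x: "x \<in> K" "\<And>z. z \<in> K \<Longrightarrow> z \<bullet> v \<le> x \<bullet> v" and s: "0 \<le> s"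
  shows "closest_point K (x + s *\<^sub>R v) = x"
proof (rule closest_point_unique[OF K x(1), symmetric], rule ballI)
  fix z assume z: "z \<in> K"
  have "(x + s *\<^sub>R v - z) \<bullet> (x + s *\<^sub>R v - z) = (x - z) \<bullet> (x - z) + 2 * (s * (x \<bullet> v - z \<bullet> v)) + (s *\<^sub>R v) \<bullet> (s *\<^sub>R v)"
    by (simp add: inner_add_left inner_add_right inner_diff_left inner_diff_right inner_commute algebra_simps)
  moreover have "0 \<le> s * (x \<bullet> v - z \<bullet> v)" using s x(2)[OF z] by simp
  ultimately have "(s *\<^sub>R v) \<bullet> (s *\<^sub>R v) \<le> (x + s *\<^sub>R v - z) \<bullet> (x + s *\<^sub>R v - z)"
    using inner_ge_zero[of "x - z"] by linarith
  then have "norm (s *\<^sub>R v) \<le> norm (x + s *\<^sub>R v - z)" by (simp only: norm_le)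
  then show "dist (x + s *\<^sub>R v) x \<le> dist (x + s *\<^sub>R v) z" by (simp add: dist_norm)
qed

text \<open>With nonempty interior, boundary points lie in the relative frontier, where a supporting
  hyperplane exists; its normal points inwards and is negated.\<close>

lemma frontier_outer_normal:
  fixes K :: "'a::euclidean_space set"
  assumes K: "convex K" "closed K" "interior K \<noteq> {}" and x: "x \<in> frontier K"
  obtains v where "v \<noteq> 0" "\<And>z. z \<in> K \<Longrightarrow> z \<bullet> v \<le> x \<bullet> v"
proof -
  have "x \<in> closure K" "x \<notin> rel_interior K"
    using x K(3) by (auto simp: frontier_def rel_interior_nonempty_interior)
  then obtain a where a: "a \<noteq> 0" "\<And>y. y \<in> closure K \<Longrightarrow> a \<bullet> x \<le> a \<bullet> y"
    using supporting_hyperplane_relative_frontier[OF K(1)] by metis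
  show ?thesis
  proof (rule that[of "- a"])
    show "z \<bullet> - a \<le> x \<bullet> - a" if "z \<in> K" for z
      using a(2)[of z] closure_subset[of K] that by (auto simp: inner_commute)
  qed (use a in simp)
qed

lemma hausdorff_outer_finite_UN:
  "finite I \<Longrightarrow> hausdorff_outer (\<Union>i\<in>I. A i) \<le> (\<Sum>i\<in>I. hausdorff_outer (A i))"
proof (induction I rule: finite_induct)
  case (insert i I)
  have "hausdorff_outer (\<Union>i\<in>insert i I. A i) \<le> hausdorff_outer (A i) + hausdorff_outer (\<Union>i\<in>I. A i)"
    by (simp add: hausdorff_outer_Un)
  also have "\<dots> \<le> hausdorff_outer (A i) + (\<Sum>i\<in>I. hausdorff_outer (A i))"
    by (intro add_left_mono insert.IH)
  finally show ?case using insert.hyps by simp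
qed (simp add: hausdorff_outer_empty)

lemma sum_lessThan_double:
  fixes g :: "nat \<Rightarrow> 'a::comm_monoid_add"
  shows "(\<Sum>j<2*m. g j) = (\<Sum>j<m. g j) + (\<Sum>j<m. g (j + m))"
proof -
  have "sum g {0..<m} + sum g {m..<m + m} = sum g {0..<m + m}"
    by (rule sum.atLeastLessThan_concat) simp_all
  moreover have "sum g {m..<m + m} = (\<Sum>j=0..<m. g (j + m))"
    using sum.shift_bounds_nat_ivl[of g 0 m m] by simp
  ultimately show ?thesis by (simp add: lessThan_atLeast0 mult_2)
qed

section \<open>The grid of \<open>2 * m\<close> equally spaced directions\<close>

context
  fixes m :: nat and t :: real
  assumes m: "m \<ge> 2" and t_def: "t = pi / real m"
begin

lemma grid_step: "real m * t = pi" "0 < t" "t < pi" "0 < sin t" "0 < sin (t/2)" "0 < cos (t/2)"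
proof -
  show a: "real m * t = pi" using m by (simp add: t_def)
  show b: "0 < t" using m by (simp add: t_def)
  have "t \<le> pi / 2" unfolding t_def using m by (intro divide_left_mono) auto
  then show c: "t < pi" using pi_gt_zero by linarith
  show "0 < sin t" using b c by (rule sin_gt_zero)
  show "0 < sin (t/2)" using b c by (intro sin_gt_zero) auto
  show "0 < cos (t/2)" using b c by (intro cos_gt_zero_pi) auto
qed

lemma dir_shift_2m: "dir (\<theta> + 2 * real m * t) = dir \<theta>"
  using grid_step(1) by (simp add: dir_def mult.assoc)

text \<open>The grid is cyclic in directions but not in indices: the neighbour after the last index
  is index 0.\<close>

lemma ex_grid_dir_Suc:
  assumes "j < 2 * m"
  obtains i where "i < 2 * m" "dir (real j * t + t) = dir (real i * t)"
proof (cases "Suc j < 2 * m")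
  case True
  then show ?thesis by (intro that[of "Suc j"]) (auto simp: algebra_simps)
next
  case False
  then have j: "real j = 2 * real m - 1" using assms by linarith
  have "real j * t + t = 0 + 2 * real m * t" unfolding j by (simp add: algebra_simps)
  then show ?thesis using m dir_shift_2m[of 0] by (intro that[of 0]) auto
qed

lemma ex_grid_dir_pred:
  assumes "j < 2 * m"
  obtains i where "i < 2 * m" "dir (real j * t - t) = dir (real i * t)"
proof (cases j)
  case 0
  have "dir (real (2 * m - 1) * t) = dir (- t + 2 * real m * t)"
    using m by (simp add: of_nat_diff algebra_simps)
  then show ?thesis using 0 m dir_shift_2m[of "- t"] by (intro that[of "2 * m - 1"]) auto
next
  case (Suc i)
  then show ?thesis using assms by (intro that[of i]) (auto simp: algebra_simps)
qed

text \<open>The grid is closed under negation, so without a positive inner product all of them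
  vanish. The directions at angles 0 and \<open>t\<close> are independent, which forces
  \<open>v = 0\<close>.\<close>

lemma ex_grid_dir_pos:
  assumes "v \<noteq> 0"
  shows "\<exists>j<2*m. 0 < v \<bullet> dir (real j * t)"
proof (rule ccontr)
  assume "\<not> ?thesis"
  then have neg: "v \<bullet> dir (real j * t) \<le> 0" if "j < 2 * m" for j using that by force
  have zero: "v \<bullet> dir (real j * t) = 0" if "j < m" for j
  proof -
    have "dir (real (j + m) * t) = - dir (real j * t)"
      using grid_step(1) by (simp add: distrib_right dir_add_pi)
    then show ?thesis using neg[of j] neg[of "j + m"] that by simp
  qed
  have "v $ 1 = 0" "v $ 1 * cos t + v $ 2 * sin t = 0"
    using zero[of 0] zero[of 1] m by (auto simp: inner_dir)
  then have "v = 0" using grid_step(4) by (auto simp: vec_eq_iff forall_2)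
  then show False using assms by simp
qed

lemma sum_grid_shift:
  fixes f :: "real^2 \<Rightarrow> real"
  shows "(\<Sum>j<2*m. f (dir (real j * t + t))) = (\<Sum>j<2*m. f (dir (real j * t)))"
    "(\<Sum>j<2*m. f (dir (real j * t - t))) = (\<Sum>j<2*m. f (dir (real j * t)))"
proof -
  have shift: "(\<Sum>j<2*m. g (Suc j)) = (\<Sum>j<2*m. g j)" if "g (2 * m) = g 0" for g :: "nat \<Rightarrow> real"
    using sum.lessThan_Suc_shift[of g "2 * m"] sum.lessThan_Suc[of g "2 * m"] that by simp
  have "dir (2 * real m * t) = dir 0" using dir_shift_2m[of 0] by simp
  then show "(\<Sum>j<2*m. f (dir (real j * t + t))) = (\<Sum>j<2*m. f (dir (real j * t)))"
    using shift[of "\<lambda>j. f (dir (real j * t))"] by (simp add: algebra_simps)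
  have "dir (2 * real m * t - t) = dir (- t)" using dir_shift_2m[of "- t"] by (simp add: add.commute)
  then show "(\<Sum>j<2*m. f (dir (real j * t - t))) = (\<Sum>j<2*m. f (dir (real j * t)))"
    using shift[of "\<lambda>j. f (dir (real j * t - t))"] by (simp add: algebra_simps)
qed

lemma sum_grid_antipodal:
  fixes f :: "real^2 \<Rightarrow> real"
  shows "(\<Sum>j<2*m. f (- dir (real j * t))) = (\<Sum>j<2*m. f (dir (real j * t)))"
proof -
  have anti: "dir (real (j + m) * t) = - dir (real j * t)" for j
    using grid_step(1) by (simp add: distrib_right dir_add_pi)
  show ?thesis unfolding sum_lessThan_double anti by simp
qed

text \<open>
  Every boundary point \<open>x\<close> with outer normal \<open>v\<close> is the nearest point in \<open>K\<close> of the point at which the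
  ray from \<open>x\<close> in direction \<open>v\<close> leaves the polygon circumscribed to \<open>K\<close> with the given normals.
\<close>

lemma frontier_subset_projected_sides:
  assumes K: "convex K" "compact K" "interior K \<noteq> {}"
  defines "h \<equiv> \<lambda>\<theta>. support_function K (dir \<theta>)"
  shows "frontier K \<subseteq> (\<Union>j<2*m.
    (\<lambda>\<tau>. closest_point K (h (real j * t) *\<^sub>R dir (real j * t) + \<tau> *\<^sub>R dir (real j * t + pi/2))) `
      {(h (real j * t) * cos t - h (real j * t - t)) / sin t .. (h (real j * t + t) - h (real j * t) * cos t) / sin t})"
proof
  fix x assume x: "x \<in> frontier K"
  have cl: "closed K" using K(2) by (rule compact_imp_closed)
  then have xK: "x \<in> K" using x by (simp add: frontier_def)
  obtain v where v: "v \<noteq> 0" "\<And>z. z \<in> K \<Longrightarrow> z \<bullet> v \<le> x \<bullet> v"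
    using frontier_outer_normal[OF K(1) cl K(3) x] by blast
  define J where "J = {j. j < 2 * m \<and> 0 < v \<bullet> dir (real j * t)}"
  \<comment> \<open>The parameter at which the ray from \<open>x\<close> along \<open>v\<close>
    meets the supporting line with normal index \<open>j\<close>; the ray approaches exactly the
    lines indexed by \<open>J\<close>.\<close>
  define r where "r j = (h (real j * t) - x \<bullet> dir (real j * t)) / (v \<bullet> dir (real j * t))" for j
  have J: "finite J" "J \<noteq> {}" using ex_grid_dir_pos[OF v(1)] by (auto simp: J_def)
  \<comment> \<open>The line met first carries the side through which the ray leaves the
    polygon.\<close>
  obtain j where j: "j \<in> J" "\<And>i. i \<in> J \<Longrightarrow> r j \<le> r i"
    using arg_min_if_finite(1)[OF J, of r] arg_min_least[OF J, of _ r] by blast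
  have xh: "x \<bullet> dir \<theta> \<le> h \<theta>" for \<theta>
    unfolding h_def using K(2) xK by (rule inner_le_support_function)
  have r0: "0 \<le> r j" using j(1) xh by (auto simp: r_def J_def)
  define y where "y = x + r j *\<^sub>R v"
  have yx: "closest_point K y = x"
    unfolding y_def using K(1) cl xK v(2) r0 by (rule closest_point_outer_normal)
  have yj: "y \<bullet> dir (real j * t) = h (real j * t)"
    using j(1) by (simp add: y_def r_def J_def inner_add_left)
  have yi: "y \<bullet> dir (real i * t) \<le> h (real i * t)" if "i < 2 * m" for i
  proof (cases "i \<in> J")
    case True
    then have "r j * (v \<bullet> dir (real i * t)) \<le> r i * (v \<bullet> dir (real i * t))"
      using j(2) by (intro mult_right_mono) (auto simp: J_def)
    also have "\<dots> = h (real i * t) - x \<bullet> dir (real i * t)" using True by (simp add: r_def J_def)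
    finally show ?thesis by (simp add: y_def inner_add_left)
  next
    case False
    then have "r j * (v \<bullet> dir (real i * t)) \<le> 0"
      using that r0 by (intro mult_nonneg_nonpos) (auto simp: J_def)
    then show ?thesis using xh[of "real i * t"] by (simp add: y_def inner_add_left)
  qed
  have j2: "j < 2 * m" using j(1) by (simp add: J_def)
  let ?\<theta> = "real j * t"
  \<comment> \<open>The position of \<open>y\<close> along this side. The constraints of the two
    neighbouring normals confine it to the stated interval.\<close>
  define \<tau> where "\<tau> = y \<bullet> dir (?\<theta> + pi/2)"
  have "y \<bullet> dir (?\<theta> + t) = cos t * h ?\<theta> + sin t * \<tau>"
    by (simp only: dir_add[of ?\<theta> t] inner_add_right inner_scaleR_right yj \<tau>_def)
  moreover have "y \<bullet> dir (?\<theta> + t) \<le> h (?\<theta> + t)"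
    using ex_grid_dir_Suc[OF j2] yi by (metis h_def)
  ultimately have up: "\<tau> \<le> (h (?\<theta> + t) - h ?\<theta> * cos t) / sin t"
    using grid_step(4) by (simp add: pos_le_divide_eq mult.commute)
  have "y \<bullet> dir (?\<theta> - t) = cos t * h ?\<theta> - sin t * \<tau>"
    by (simp only: dir_diff inner_diff_right inner_scaleR_right yj \<tau>_def)
  moreover have "y \<bullet> dir (?\<theta> - t) \<le> h (?\<theta> - t)"
    using ex_grid_dir_pred[OF j2] yi by (metis h_def)
  ultimately have lo: "(h ?\<theta> * cos t - h (?\<theta> - t)) / sin t \<le> \<tau>"
    using grid_step(4) by (simp add: pos_divide_le_eq mult.commute)
  have "y = h ?\<theta> *\<^sub>R dir ?\<theta> + \<tau> *\<^sub>R dir (?\<theta> + pi/2)"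
    using dir_orthonormal_expansion[of y ?\<theta>] by (simp add: yj \<tau>_def)
  then have "x = closest_point K (h ?\<theta> *\<^sub>R dir ?\<theta> + \<tau> *\<^sub>R dir (?\<theta> + pi/2))"
    using yx by simp
  then show "x \<in> (\<Union>j<2*m.
    (\<lambda>\<tau>. closest_point K (h (real j * t) *\<^sub>R dir (real j * t) + \<tau> *\<^sub>R dir (real j * t + pi/2))) `
      {(h (real j * t) * cos t - h (real j * t - t)) / sin t .. (h (real j * t + t) - h (real j * t) * cos t) / sin t})"
    using up lo j2 by (intro UN_I[of j] image_eqI[of _ _ \<tau>]) auto
qed

text \<open>Since nearest points depend on the point in a 1-Lipschitz way, the side lengths
  \<open>b j - a j\<close> bound the pieces of the boundary. In their sum, cyclic shifts replace the
  neighbouring support values by those at \<open>real j * t\<close>.\<close>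

lemma hausdorff_outer_frontier_le:
  assumes K: "convex K" "compact K" "interior K \<noteq> {}"
  shows "hausdorff_outer (frontier K)
    \<le> ennreal (2 * ((1 - cos t) / sin t) * (\<Sum>j<2*m. support_function K (dir (real j * t))))"
proof -
  define h where "h \<theta> = support_function K (dir \<theta>)" for \<theta>
  have ne: "K \<noteq> {}" using K(3) interior_subset by fastforce
  define a where "a j = (h (real j * t) * cos t - h (real j * t - t)) / sin t" for j
  define b where "b j = (h (real j * t + t) - h (real j * t) * cos t) / sin t" for j
  define f where "f j \<tau> = closest_point K (h (real j * t) *\<^sub>R dir (real j * t) + \<tau> *\<^sub>R dir (real j * t + pi/2))" for j \<tau>
  \<comment> \<open>A point of \<open>K\<close> on the supporting line satisfies both neighbouring
    constraints, so the side is nonempty.\<close>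
  have ab: "a j \<le> b j" for j
  proof -
    obtain x where x: "x \<in> K" "h (real j * t) = x \<bullet> dir (real j * t)"
      using support_function_attained[OF K(2) ne] unfolding h_def by blast
    have "x \<bullet> dir (real j * t + t) + x \<bullet> dir (real j * t - t) = 2 * (cos t * (x \<bullet> dir (real j * t)))"
      by (simp only: dir_add[of _ t] dir_diff inner_add_right inner_diff_right inner_scaleR_right)
    moreover have "x \<bullet> dir (real j * t + t) \<le> h (real j * t + t)" "x \<bullet> dir (real j * t - t) \<le> h (real j * t - t)"
      unfolding h_def using K(2) x(1) by (auto intro: inner_le_support_function)
    ultimately have "h (real j * t) * cos t - h (real j * t - t) \<le> h (real j * t + t) - h (real j * t) * cos t"
      unfolding x(2) mult.commute[of _ "cos t"] by linarith
    then show ?thesis unfolding a_def b_def using grid_step(4) by (intro divide_right_mono) auto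
  qed
  have lip: "1-lipschitz_on X (f j)" for X j
  proof (rule lipschitz_onI)
    fix \<sigma> \<tau> :: real
    have "dist (f j \<sigma>) (f j \<tau>) \<le> dist (h (real j * t) *\<^sub>R dir (real j * t) + \<sigma> *\<^sub>R dir (real j * t + pi/2))
        (h (real j * t) *\<^sub>R dir (real j * t) + \<tau> *\<^sub>R dir (real j * t + pi/2))"
      unfolding f_def using K ne by (intro closest_point_lipschitz compact_imp_closed)
    also have "\<dots> = 1 * dist \<sigma> \<tau>"
      by (simp add: dist_norm norm_dir flip: scaleR_diff_left)
    finally show "dist (f j \<sigma>) (f j \<tau>) \<le> 1 * dist \<sigma> \<tau>" .
  qed simp
  have "frontier K \<subseteq> (\<Union>j<2*m. f j ` {a j..b j})"
    using frontier_subset_projected_sides[OF K] unfolding f_def a_def b_def h_def .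
  then have "hausdorff_outer (frontier K) \<le> hausdorff_outer (\<Union>j<2*m. f j ` {a j..b j})"
    by (rule hausdorff_outer_mono)
  also have "\<dots> \<le> (\<Sum>j<2*m. hausdorff_outer (f j ` {a j..b j}))"
    by (rule hausdorff_outer_finite_UN) simp
  also have "\<dots> \<le> (\<Sum>j<2*m. ennreal (b j - a j))"
    by (intro sum_mono hausdorff_outer_lipschitz_image_le lip ab)
  also have "\<dots> = ennreal (\<Sum>j<2*m. b j - a j)"
    using ab by (intro sum_ennreal) auto
  also have "(\<Sum>j<2*m. b j - a j)
      = (\<Sum>j<2*m. (h (real j * t + t) + h (real j * t - t) - 2 * cos t * h (real j * t)) / sin t)"
    by (intro sum.cong) (auto simp: a_def b_def simp flip: diff_divide_distrib)
  also have "\<dots> = ((\<Sum>j<2*m. h (real j * t + t)) + (\<Sum>j<2*m. h (real j * t - t))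
      - 2 * cos t * (\<Sum>j<2*m. h (real j * t))) / sin t"
    by (simp only: sum_divide_distrib[symmetric] sum.distrib sum_subtractf sum_distrib_left)
  also have "\<dots> = 2 * ((1 - cos t) / sin t) * (\<Sum>j<2*m. h (real j * t))"
    unfolding h_def sum_grid_shift by (simp add: algebra_simps flip: add_divide_distrib diff_divide_distrib)
  finally show ?thesis by (simp only: h_def)
qed

text \<open>
  The sum is \<open>t\<close>-periodic in \<open>\<theta>\<close>, so the angles may be assumed to lie where the cosine is nonnegative;
  there the sum telescopes.
\<close>

lemma sum_abs_cos_grid_le: "(\<Sum>j<m. \<bar>cos (\<theta> + real j * t)\<bar>) \<le> 1 / sin (t/2)"
proof -
  define f where "f \<theta> = (\<Sum>j<m. \<bar>cos (\<theta> + real j * t)\<bar>)" for \<theta>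
  have step: "f (\<theta> + t) = f \<theta>" for \<theta>
  proof -
    define g where "g j = \<bar>cos (\<theta> + real j * t)\<bar>" for j
    \<comment> \<open>\<open>m\<close> steps add \<open>pi\<close>, which only changes the sign of
      the cosine.\<close>
    have "g m = g 0" using grid_step(1) by (simp add: g_def)
    then have "(\<Sum>j<m. g (Suc j)) = (\<Sum>j<m. g j)"
      using sum.lessThan_Suc_shift[of g m] sum.lessThan_Suc[of g m] by simp
    then show ?thesis by (simp add: f_def g_def algebra_simps)
  qed
  have shift: "f (\<theta> + real_of_int k * t) = f \<theta>" for \<theta> k
  proof (induction k rule: int_induct[where k=0])
    case (step1 i)
    then show ?case using step[of "\<theta> + real_of_int i * t"] by (simp add: algebra_simps)
  next
    case (step2 i)
    then show ?case using step[of "\<theta> + real_of_int (i - 1) * t"] by (simp add: algebra_simps)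
  qed simp
  \<comment> \<open>Chosen so that \<open>\<psi>\<close> lies between \<open>- pi/2\<close> and
    \<open>t - pi/2\<close>; the remaining \<open>m - 1\<close> steps then end no later than
    \<open>pi/2\<close>.\<close>
  define k where "k = \<lfloor>(\<theta> + pi/2) / t\<rfloor>"
  define \<psi> where "\<psi> = \<theta> - real_of_int k * t"
  have "real_of_int k * t \<le> \<theta> + pi/2" "\<theta> + pi/2 \<le> (real_of_int k + 1) * t"
    using grid_step(2) floor_correct[of "(\<theta> + pi/2) / t"]
    by (auto simp: k_def pos_le_divide_eq[symmetric] pos_divide_le_eq[symmetric] less_imp_le)
  then have \<psi>: "- (pi/2) \<le> \<psi>" "\<psi> \<le> t - pi/2"
    by (auto simp: \<psi>_def algebra_simps)
  have nonneg: "0 \<le> cos (\<psi> + real j * t)" if "j < m" for j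
  proof (rule cos_ge_zero)
    have "(1 + real j) * t \<le> real m * t" using that grid_step(2) by (intro mult_right_mono) auto
    then show "\<psi> + real j * t \<le> pi/2" using \<psi>(2) grid_step(1) by (simp add: algebra_simps)
    have "0 \<le> real j * t" using grid_step(2) by simp
    then show "- (pi/2) \<le> \<psi> + real j * t" using \<psi>(1) by linarith
  qed
  \<comment> \<open>The factor \<open>2 * sin (t/2)\<close> turns each cosine into a difference of
    two sines half a step to either side.\<close>
  have "2 * sin (t/2) * f \<psi> = (\<Sum>j<m. 2 * sin (t/2) * cos (\<psi> + real j * t))"
    unfolding f_def sum_distrib_left using nonneg by (intro sum.cong) auto
  also have "\<dots> = (\<Sum>j<m. sin (\<psi> - t/2 + real (Suc j) * t) - sin (\<psi> - t/2 + real j * t))"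
  proof (intro sum.cong refl)
    fix j
    have e: "\<psi> - t/2 + real (Suc j) * t = (\<psi> + real j * t) + t/2"
      "\<psi> - t/2 + real j * t = (\<psi> + real j * t) - t/2" by (auto simp: algebra_simps)
    show "2 * sin (t/2) * cos (\<psi> + real j * t)
        = sin (\<psi> - t/2 + real (Suc j) * t) - sin (\<psi> - t/2 + real j * t)"
      unfolding e sin_add sin_diff by simp
  qed
  also have "\<dots> = sin (\<psi> - t/2 + real m * t) - sin (\<psi> - t/2 + real 0 * t)"
    by (rule sum_lessThan_telescope)
  also have "\<dots> \<le> 2" using sin_le_one[of "\<psi> - t/2 + real m * t"] sin_ge_minus_one[of "\<psi> - t/2 + real 0 * t"]
    by linarith
  finally have "f \<psi> \<le> 1 / sin (t/2)" using grid_step(5) by (simp add: pos_le_divide_eq mult.commute)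
  moreover have "f \<theta> = f \<psi>" using shift[of \<psi> k] by (simp add: \<psi>_def)
  ultimately show ?thesis by (simp add: f_def)
qed

text \<open>In polar form the inner products are multiples of shifted cosines; each half of the grid
  is a sum over \<open>m\<close> steps, bounded by \<open>sum_abs_cos_grid_le\<close>.\<close>

lemma sum_abs_inner_grid_le: "(\<Sum>j<2*m. \<bar>x \<bullet> dir (real j * t)\<bar>) \<le> 2 * norm x / sin (t/2)"
proof -
  obtain \<phi> where \<phi>: "x = norm x *\<^sub>R dir \<phi>" by (rule polar_form)
  have "x \<bullet> dir \<theta> = norm x * cos (\<theta> - \<phi>)" for \<theta>
    by (subst \<phi>) (simp add: inner_dir_dir)
  then have eq: "(\<Sum>j<2*m. \<bar>x \<bullet> dir (real j * t)\<bar>) = norm x * (\<Sum>j<2*m. \<bar>cos (- \<phi> + real j * t)\<bar>)"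
    by (simp add: abs_mult sum_distrib_left algebra_simps)
  have "(\<Sum>j<2*m. \<bar>cos (- \<phi> + real j * t)\<bar>)
      = (\<Sum>j<m. \<bar>cos (- \<phi> + real j * t)\<bar>) + (\<Sum>j<m. \<bar>cos (- \<phi> + real (j + m) * t)\<bar>)"
    by (rule sum_lessThan_double)
  also have "(\<Sum>j<m. \<bar>cos (- \<phi> + real (j + m) * t)\<bar>) = (\<Sum>j<m. \<bar>cos (- \<phi> + pi + real j * t)\<bar>)"
  proof -
    have "- \<phi> + real (j + m) * t = - \<phi> + pi + real j * t" for j
      using grid_step(1) by (simp add: distrib_right)
    then show ?thesis by (simp only:)
  qed
  also have "(\<Sum>j<m. \<bar>cos (- \<phi> + real j * t)\<bar>) + \<dots> \<le> 1 / sin (t/2) + 1 / sin (t/2)"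
    by (intro add_mono sum_abs_cos_grid_le)
  finally have "(\<Sum>j<2*m. \<bar>cos (- \<phi> + real j * t)\<bar>) \<le> 2 / sin (t/2)" by simp
  from mult_left_mono[OF this norm_ge_zero[of x]] show ?thesis
    unfolding eq by (simp add: mult.commute)
qed

end

section \<open>The characterisation of weak barriers\<close>

text \<open>A discrete form of Cauchy's perimeter formula: pairing antipodal directions turns
  support values into widths, and exchanging the sums lets each segment be estimated
  separately.\<close>

lemma hausdorff_outer_frontier_le_of_width:
  fixes K :: "(real^2) set"
  assumes S: "finite S" and K: "convex K" "compact K" "interior K \<noteq> {}" and m: "m \<ge> 2"
    and width: "\<And>k l u. k \<in> K \<Longrightarrow> l \<in> K \<Longrightarrow> (k - l) \<bullet> u \<le> (\<Sum>(a, b)\<in>S. \<bar>(b - a) \<bullet> u\<bar>)"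
  shows "hausdorff_outer (frontier K) \<le> ennreal (2 * (\<Sum>(a, b)\<in>S. dist a b) / cos (pi / 2 / real m))"
proof -
  define t where "t = pi / real m"
  note grid = grid_step[OF m t_def]
  define L where "L = (\<Sum>(a, b)\<in>S. dist a b)"
  define H where "H = (\<Sum>j<2*m. support_function K (dir (real j * t)))"
  have ne: "K \<noteq> {}" using K(3) interior_subset by fastforce
  have w: "support_function K u + support_function K (- u) \<le> (\<Sum>(a, b)\<in>S. \<bar>(b - a) \<bullet> u\<bar>)" for u
  proof -
    obtain k where k: "k \<in> K" "support_function K u = k \<bullet> u"
      using support_function_attained[OF K(2) ne] by blast
    obtain l where l: "l \<in> K" "support_function K (- u) = l \<bullet> (- u)"
      using support_function_attained[OF K(2) ne] by blast
    show ?thesis using width[OF k(1) l(1), of u] by (simp add: k(2) l(2) inner_diff_left)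
  qed
  have "2 * H = (\<Sum>j<2*m. support_function K (dir (real j * t)) + support_function K (- dir (real j * t)))"
    unfolding H_def sum.distrib sum_grid_antipodal[OF m t_def] by simp
  also have "\<dots> \<le> (\<Sum>j<2*m. \<Sum>(a, b)\<in>S. \<bar>(b - a) \<bullet> dir (real j * t)\<bar>)"
    by (intro sum_mono w)
  also have "\<dots> = (\<Sum>(a, b)\<in>S. \<Sum>j<2*m. \<bar>(b - a) \<bullet> dir (real j * t)\<bar>)"
    unfolding case_prod_unfold by (rule sum.swap)
  also have "\<dots> \<le> (\<Sum>(a, b)\<in>S. 2 * dist a b / sin (t/2))"
    unfolding case_prod_unfold
  proof (rule sum_mono)
    fix p
    show "(\<Sum>j<2*m. \<bar>(snd p - fst p) \<bullet> dir (real j * t)\<bar>) \<le> 2 * dist (fst p) (snd p) / sin (t/2)"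
      using sum_abs_inner_grid_le[OF m t_def, of "snd p - fst p"]
      by (simp only: dist_norm norm_minus_commute[of "fst p"])
  qed
  also have "\<dots> = 2 * L / sin (t/2)"
    by (simp add: L_def case_prod_unfold sum_divide_distrib sum_distrib_left)
  finally have H: "H \<le> L / sin (t/2)" by simp
  \<comment> \<open>Both sides are the tangent of \<open>t/2\<close>; in this form its numerator
    cancels the denominator in the bound on \<open>H\<close>.\<close>
  have c: "(1 - cos t) / sin t = sin (t/2) / cos (t/2)"
  proof -
    have "1 - cos t = 2 * sin (t/2) * sin (t/2)" "sin t = 2 * sin (t/2) * cos (t/2)"
      using cos_double_sin[of "t/2"] sin_double[of "t/2"] by (auto simp: power2_eq_square)
    then show ?thesis using grid(5) by simp
  qed
  have "2 * ((1 - cos t) / sin t) * H \<le> 2 * ((1 - cos t) / sin t) * (L / sin (t/2))"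
    unfolding c using grid H by (intro mult_left_mono) auto
  also have "\<dots> = 2 * L / cos (t/2)" unfolding c using grid by simp
  also have "t / 2 = pi / 2 / real m" by (simp add: t_def)
  finally have le: "2 * ((1 - cos t) / sin t) * H \<le> 2 * L / cos (pi / 2 / real m)" .
  have "hausdorff_outer (frontier K) \<le> ennreal (2 * ((1 - cos t) / sin t) * H)"
    unfolding H_def by (rule hausdorff_outer_frontier_le[OF m t_def K])
  also have "\<dots> \<le> ennreal (2 * L / cos (pi / 2 / real m))"
    using le by (rule ennreal_leI)
  finally show ?thesis by (simp only: L_def)
qed

text \<open>The left side of the polygonal estimate is free of \<open>m\<close>, so the factor
  \<open>1 / cos (pi / 2 / real m)\<close> disappears in the limit; the estimate for
  \<open>m \<ge> 2\<close> is enough for this.\<close>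

lemma emeasure_hausdorff_frontier_le:
  fixes K :: "(real^2) set"
  assumes S: "finite S" and K: "convex K" "compact K" "interior K \<noteq> {}"
    and width: "\<And>k l u. k \<in> K \<Longrightarrow> l \<in> K \<Longrightarrow> (k - l) \<bullet> u \<le> (\<Sum>(a, b)\<in>S. \<bar>(b - a) \<bullet> u\<bar>)"
  shows "emeasure hausdorff (frontier K) \<le> ennreal (2 * (\<Sum>(a, b)\<in>S. dist a b))"
proof -
  let ?L = "\<Sum>(a, b)\<in>S. dist a b"
  have "(\<lambda>m. 2 * ?L / cos (pi / 2 / real m)) \<longlonglongrightarrow> 2 * ?L / cos 0"
    by (intro tendsto_intros lim_const_over_n) auto
  then have "(\<lambda>m. ennreal (2 * ?L / cos (pi / 2 / real m))) \<longlonglongrightarrow> ennreal (2 * ?L)"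
    by (intro tendsto_ennrealI) simp
  then have "hausdorff_outer (frontier K) \<le> ennreal (2 * ?L)"
    using hausdorff_outer_frontier_le_of_width[OF S K _ width]
    by (intro LIMSEQ_le_const) auto
  then show ?thesis by (simp add: emeasure_hausdorff borel_closed)
qed

theorem proposition1p1:
  fixes B K :: "(real^2) set"
  assumes "finite_segment_union B"
    and "convex_body K" and "interior K \<noteq> {}"
  shows "(weak_barrier B K \<longleftrightarrow> blaschke_body K \<subseteq> convexification B) \<and>
         (weak_barrier B K \<longrightarrow> emeasure hausdorff B \<ge> emeasure hausdorff (frontier K) / 2)"
proof -
  obtain S where S: "segment_decomposition S B"
    using assms(1) by (rule segment_decomposition_exists)
  then have fin: "finite S" by (simp add: segment_decomposition_def nondegenerate_segments_def)
  have K: "convex K" "compact K" using assms(2) by (auto simp: convex_body_def)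
  have "emeasure hausdorff (frontier K) / 2 \<le> emeasure hausdorff B" if "weak_barrier B K"
  proof -
    have "emeasure hausdorff (frontier K) \<le> ennreal (2 * (\<Sum>(a, b)\<in>S. dist a b))"
      using that weak_barrier_iff[OF S assms(2)]
      by (intro emeasure_hausdorff_frontier_le[OF fin K assms(3)]) blast
    also have "\<dots> = 2 * emeasure hausdorff B"
      by (simp add: emeasure_hausdorff_segment_decomposition[OF S] ennreal_mult' case_prod_unfold sum_nonneg)
    finally show ?thesis
      by (simp add: divide_le_posI_ennreal mult.commute)
  qed
  \<comment> \<open>Both conditions reduce to the same family of inequalities between
    \<open>(k - l) \<bullet> u\<close> and the projection sums.\<close>
  moreover have "weak_barrier B K \<longleftrightarrow> blaschke_body K \<subseteq> convexification B"
    unfolding weak_barrier_iff[OF S assms(2)] convexification_eq_zonogon[OF S]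
      blaschke_body_subset_zonogon_iff[OF fin] by (rule refl)
  ultimately show ?thesis by blast
qed

end
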